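(* The following implications hold for a graph $G$. (1) If $G$ is bipartite and has the usual Sidorenko property, then $G$ is KNRS. (2) If $G$ is KNRS, then $G$ is regular-KNRS. (3) If $G$ is Sidorenko-good, then $G$ is regular-KNRS. (4) If $G$ is regular-KNRS, then the $1$-subdivision $\operatorname{Sub}(G)$ has the Sidorenko property. Consequently, KNRS implies regular-KNRS, which implies that the $1$-subdivision is Sidorenko; and Sidorenko-good implies regular-KNRS, which implies that the $1$-subdivision is Sidorenko.
   Context: Graphs are finite and loopless; parallel edges are allowed, and $e(H)$ counts edges with multiplicity. A graphon is a symmetric measurable function $W:[0,1]^2\to[0,1]$; a kernel is a bounded symmetric measurable function $K:[0,1]^2\to\mathbb{R}$. For a graph $H$ and a nonnegative kernel $K$, $$t(H,K)=\int_{[0,1]^{V(H)}}\prod_{ij\in E(H)}K(x_i,x_j)\prod_{i\in V(H)}dx_i,$$ with the product over edges taken with multiplicity. For $\rho\in[0,1]$, a graphon $W$ is $\rho$-locally dense if $\int_{S\times S}W\,dx\,dy\ge\rho\,\lambda(S)^2$ for every measurable $S\subseteq[0,1]$ ($\lambda$ is Lebesgue measure), and $\rho$-regular if $\int_0^1W(x,y)\,dy=\rho$ for a.e. $x\in[0,1]$. A graph $H$ has the (usual) Sidorenko property (is Sidorenko) if $t(H,W)\ge t(K_2,W)^{e(H)}$ for every graphon $W$. $H$ is KNRS if $t(H,W)\ge\rho^{e(H)}$ for every $\rho\in[0,1]$ and every $\rho$-locally dense graphon $W$. $H$ is regular-KNRS if $t(H,W)\ge\rho^{e(H)}$ for every $\rho\in[0,1]$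 and every graphon $W$ that is both $\rho$-locally dense and $\rho$-regular. A kernel $K$ is doubly nonnegative if $K\ge0$ a.e. and $\int_{[0,1]^2}f(x)K(x,y)f(y)\,dx\,dy\ge0$ for every bounded measurable $f:[0,1]\to\mathbb{R}$. For a nonnegative kernel, $\|K\|_1=\int_{[0,1]^2}K\,dx\,dy$. $H$ is Sidorenko-good if $t(H,K)\ge\|K\|_1^{e(H)}$ for every (bounded) doubly nonnegative kernel $K$. The $1$-subdivision $\operatorname{Sub}(G)$ is obtained from $G$ by replacing every edge with a path of length two (with a new internal vertex for each edge). *)

theory Defs
  imports "HOL-Analysis.Analysis"
begin

section \<open>Finite loopless multigraphs\<close>

text \<open>Edges are labelled: parallel edges are distinct labels with the same pair of ends.\<close>

record ('v, 'e) mgraph =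
  verts :: "'v set"
  edges :: "'e set"
  ends :: "'e \<Rightarrow> 'v set"

definition loopless_multigraph :: "('v, 'e) mgraph \<Rightarrow> bool" where
  "loopless_multigraph G \<longleftrightarrow> finite (verts G) \<and> finite (edges G) \<and>
     (\<forall>e\<in>edges G. ends G e \<subseteq> verts G \<and> card (ends G e) = 2)"

definition bipartite :: "('v, 'e) mgraph \<Rightarrow> bool" where
  "bipartite G \<longleftrightarrow> (\<exists>A B. A \<union> B = verts G \<and> A \<inter> B = {} \<and>
     (\<forall>e\<in>edges G. \<exists>a\<in>A. \<exists>b\<in>B. ends G e = {a, b}))"

definition K2 :: "(nat, nat) mgraph" where
  "K2 = \<lparr>verts = {0, 1}, edges = {0}, ends = (\<lambda>_. {0, 1})\<rparr>"

text \<open>The new vertex inside the edge \<open>e\<close> is \<open>Inr e\<close>; the half of \<open>e\<close> at its end \<open>v\<close>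
  is the edge labelled \<open>(e, v)\<close>.\<close>

definition Sub :: "('v, 'e) mgraph \<Rightarrow> ('v + 'e, 'e \<times> 'v) mgraph" where
  "Sub G = \<lparr>verts = Inl ` verts G \<union> Inr ` edges G,
            edges = (SIGMA e : edges G. ends G e),
            ends = (\<lambda>(e, v). {Inr e, Inl v})\<rparr>"

lemma loopless_multigraph_K2: "loopless_multigraph K2"
  by (simp add: loopless_multigraph_def K2_def)

lemma loopless_multigraph_Sub:
  assumes "loopless_multigraph G"
  shows "loopless_multigraph (Sub G)"
  using assms unfolding loopless_multigraph_def Sub_def
  by (auto intro: finite_subset)

section \<open>Kernels and graphons\<close>

text \<open>``Measurable'' means Lebesgue measurable throughout. A kernel is a total function on the
  plane of which only the values on the unit square matter.\<close>

abbreviation I01 :: "real set" where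
  "I01 \<equiv> {0..1}"

definition kernel :: "(real \<times> real \<Rightarrow> real) \<Rightarrow> bool" where
  "kernel K \<longleftrightarrow> K \<in> borel_measurable (lebesgue_on (I01 \<times> I01)) \<and>
     bounded (K ` (I01 \<times> I01)) \<and>
     (\<forall>x\<in>I01. \<forall>y\<in>I01. K (x, y) = K (y, x))"

definition graphon :: "(real \<times> real \<Rightarrow> real) \<Rightarrow> bool" where
  "graphon W \<longleftrightarrow> W \<in> borel_measurable (lebesgue_on (I01 \<times> I01)) \<and>
     W ` (I01 \<times> I01) \<subseteq> {0..1} \<and>
     (\<forall>x\<in>I01. \<forall>y\<in>I01. W (x, y) = W (y, x))"

lemma graphon_imp_kernel: "graphon W \<Longrightarrow> kernel W"
  unfolding graphon_def kernel_def
  by (meson bounded_closed_interval bounded_subset)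

definition locally_dense :: "real \<Rightarrow> (real \<times> real \<Rightarrow> real) \<Rightarrow> bool" where
  "locally_dense \<rho> W \<longleftrightarrow> (\<forall>S. S \<in> sets lebesgue \<and> S \<subseteq> I01 \<longrightarrow>
     (LINT p:S \<times> S|lebesgue. W p) \<ge> \<rho> * (measure lebesgue S)\<^sup>2)"

definition regular_graphon :: "real \<Rightarrow> (real \<times> real \<Rightarrow> real) \<Rightarrow> bool" where
  "regular_graphon \<rho> W \<longleftrightarrow>
     (AE x in lebesgue_on I01. (LINT y:I01|lebesgue. W (x, y)) = \<rho>)"

definition doubly_nonnegative :: "(real \<times> real \<Rightarrow> real) \<Rightarrow> bool" where
  "doubly_nonnegative K \<longleftrightarrow> kernel K \<and>
     (AE p in lebesgue_on (I01 \<times> I01). 0 \<le> K p) \<and>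
     (\<forall>f :: real \<Rightarrow> real. f \<in> borel_measurable (lebesgue_on I01) \<and> bounded (f ` I01) \<longrightarrow>
        (LINT p:I01 \<times> I01|lebesgue. f (fst p) * K p * f (snd p)) \<ge> 0)"

text \<open>The 1-norm of a kernel that is nonnegative almost everywhere, hence no absolute value.\<close>

definition kernel_norm1 :: "(real \<times> real \<Rightarrow> real) \<Rightarrow> real" where
  "kernel_norm1 K = (LINT p:I01 \<times> I01|lebesgue. K p)"

section \<open>Homomorphism densities\<close>

text \<open>The common value of \<open>K (x u, x v)\<close> and \<open>K (x v, x u)\<close> on an edge with ends \<open>u\<close>, \<open>v\<close>.\<close>

definition edge_value ::
    "('v, 'e) mgraph \<Rightarrow> (real \<times> real \<Rightarrow> real) \<Rightarrow> ('v \<Rightarrow> real) \<Rightarrow> 'e \<Rightarrow> real" where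
  "edge_value H K x e = (THE c. \<exists>u v. ends H e = {u, v} \<and> u \<noteq> v \<and> c = K (x u, x v))"

lemma edge_value_eq:
  assumes "ends H e = {u, v}" "u \<noteq> v" "K (x u, x v) = K (x v, x u)"
  shows "edge_value H K x e = K (x u, x v)"
  unfolding edge_value_def
proof (rule the_equality)
  show "\<exists>a b. ends H e = {a, b} \<and> a \<noteq> b \<and> K (x u, x v) = K (x a, x b)"
    using assms by blast
  show "c = K (x u, x v)" if "\<exists>a b. ends H e = {a, b} \<and> a \<noteq> b \<and> c = K (x a, x b)" for c
    using that assms by (auto simp: doubleton_eq_iff)
qed

text \<open>The completed product measure is Lebesgue measure on the cube indexed by \<open>verts H\<close>; without
  completion the integrand need not be measurable, as \<open>K\<close> is only Lebesgue measurable.\<close>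

definition hom_density :: "('v, 'e) mgraph \<Rightarrow> (real \<times> real \<Rightarrow> real) \<Rightarrow> real" where
  "hom_density H K =
     (LINT x|completion (PiM (verts H) (\<lambda>_. lebesgue_on I01)).
       (\<Prod>e\<in>edges H. edge_value H K x e))"

section \<open>Sidorenko-type properties\<close>

definition sidorenko :: "('v, 'e) mgraph \<Rightarrow> bool" where
  "sidorenko H \<longleftrightarrow>
     (\<forall>W. graphon W \<longrightarrow> hom_density H W \<ge> hom_density K2 W ^ card (edges H))"

definition KNRS :: "('v, 'e) mgraph \<Rightarrow> bool" where
  "KNRS H \<longleftrightarrow> (\<forall>\<rho>\<in>{0..1}. \<forall>W. graphon W \<and> locally_dense \<rho> W \<longrightarrow>
     hom_density H W \<ge> \<rho> ^ card (edges H))"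

definition regular_KNRS :: "('v, 'e) mgraph \<Rightarrow> bool" where
  "regular_KNRS H \<longleftrightarrow>
     (\<forall>\<rho>\<in>{0..1}. \<forall>W. graphon W \<and> locally_dense \<rho> W \<and> regular_graphon \<rho> W \<longrightarrow>
        hom_density H W \<ge> \<rho> ^ card (edges H))"

definition sidorenko_good :: "('v, 'e) mgraph \<Rightarrow> bool" where
  "sidorenko_good H \<longleftrightarrow>
     (\<forall>K. doubly_nonnegative K \<longrightarrow> hom_density H K \<ge> kernel_norm1 K ^ card (edges H))"

end

theory Submission
  imports Defs "HOL-Library.Nat_Bijection"
begin

text \<open>The first implication is immediate: applied to the whole interval, local density says that the edge
density of \<open>W\<close> is at least \<open>\<rho>\<close>. The second one only restricts the class of graphons. The two
implications that need a proof are the third and the fourth.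

A \<open>\<rho>\<close>-locally dense and \<open>\<rho>\<close>-regular graphon \<open>W\<close> is doubly nonnegative. Put \<open>K = W - \<rho>\<close>. Local density
says that the quadratic form of \<open>K\<close> is nonnegative on indicator functions. It is then nonnegative on
functions with values in \<open>[0, 1]\<close>: cut \<open>[0, 1]\<close> into \<open>n\<close> pieces and round the function to an indicator
on one piece after the other. On a single piece the form is linear in the function up to an error of
the order of the squared length of the piece, and a linear functional does not increase if the
function is rounded up where the coefficient is negative and down elsewhere; the total error is
\<open>O(1/n)\<close>. Regularity says that constants lie in the kernel of the form, so every bounded function can
be shifted and scaled into \<open>[0, 1]\<close>. Hence \<open>K\<close>, and with it \<open>W = K + \<rho>\<close>, is positive semidefinite, and
a Sidorenko-good graph satisfies the required inequality on \<open>W\<close>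
(\<open>dense_regular_imp_doubly_nonnegative\<close>).

For the subdivision, \<open>t(Sub G, W) = t(G, W \<circ> W)\<close>, where \<open>W \<circ> W\<close> is the codegree kernel. If \<open>W\<close> is
\<open>p\<close>-regular, then \<open>W \<circ> W\<close> is \<open>p\<^sup>2\<close>-regular, and by the Cauchy-Schwarz inequality it is \<open>p\<^sup>2\<close>-locally dense,
so that the regular-KNRS property gives the claim. The difficulty is to reduce to regular \<open>W\<close>. This is
done for matrices on finite probability spaces, in two steps.

Up to a constant factor (\<open>finite_sidorenko_up_to_constant\<close>): discarding points of low degree
leaves a set \<open>A\<close> that carries at least half of the edge mass and on which every degree is at least a quarter
of the average degree. Replace the underlying measure on \<open>A\<close> by the one proportional to the degree, and
divide \<open>W\<close> by the product of the densities of the new measure at the two points. The new matrix is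
exactly regular, and the change of measure costs at most a constant factor that depends on \<open>G\<close>
alone, as each vertex that is not isolated is met by a half-edge.

Removing the constant (\<open>finite_sidorenko\<close>): both sides of the inequality are multiplicative under tensor
products, so a violation on one space would be amplified by repeated tensor squaring until it
contradicts the inequality up to a constant.

Finite probability spaces correspond to step kernels. In one direction a weighted matrix is realised as a
step graphon and scaled into \<open>[0, 1]\<close>, which turns the regular-KNRS property into a statement about
matrices (\<open>regular_KNRS_imp_finite\<close>). In the other direction the set of graphons that satisfy the
Sidorenko inequality is closed under almost everywhere limits, and every graphon is reached from
step graphons by two such limits, through continuous graphons (\<open>regular_KNRS_imp_sidorenko_Sub\<close>).\<close>

section \<open>Lebesgue measure on the unit square and pairs of coordinates in a cube\<close>

text \<open>Lebesgue measure on \<open>[0, 1]\<close>, carried to the Borel sets of the whole line. Products of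
\<open>unif\<close> obey Fubini's theorem directly, which the completed measure of the plane does not.\<close>

definition unif :: "real measure" where
  "unif = distr (lebesgue_on I01) borel (\<lambda>x. x)"

abbreviation cube :: "'v set \<Rightarrow> ('v \<Rightarrow> real) measure" where
  "cube V \<equiv> completion (PiM V (\<lambda>_. lebesgue_on I01))"

lemma id_measurable_lebesgue_on: "(\<lambda>x. x) \<in> borel_measurable (lebesgue_on S)"
  for S :: "'a::euclidean_space set"
  by (rule measurable_restrict_space1) (simp add: measurable_completion)

lemma square_sets [simp, measurable]:
  "I01 \<times> I01 \<in> sets (borel :: (real \<times> real) measure)" "I01 \<times> I01 \<in> sets (lebesgue :: (real \<times> real) measure)"
proof -
  show "I01 \<times> I01 \<in> sets (borel :: (real \<times> real) measure)" by (intro borel_Times) auto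
  then show "I01 \<times> I01 \<in> sets (lebesgue :: (real \<times> real) measure)" by auto
qed

lemma space_unif [simp]: "space unif = UNIV" and sets_unif [measurable_cong]: "sets unif = sets borel"
  by (simp_all add: unif_def)

lemma emeasure_unif: "A \<in> sets borel \<Longrightarrow> emeasure unif A = emeasure lborel (A \<inter> I01)"
  unfolding unif_def
  by (subst emeasure_distr[OF id_measurable_lebesgue_on])
     (auto simp: emeasure_restrict_space Int_commute)

lemma finite_measure_unif: "finite_measure unif"
  by (rule finite_measureI) (simp add: emeasure_unif)

lemma finite_measure_lebesgue_on_I01: "finite_measure (lebesgue_on I01)"
  by (rule finite_measureI) (simp add: emeasure_restrict_space)

text \<open>Together with \<open>distr_PiM_pair\<close> this is the bridge between three measures: Lebesgue measure on the
square, the product \<open>unif \<Otimes>\<^sub>M unif\<close>, and the law of two coordinates of a point of the cube. They agree on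
rectangles, hence on all Borel sets.\<close>

lemma pair_unif:
  "unif \<Otimes>\<^sub>M unif = distr (lebesgue_on (I01 \<times> I01)) borel (\<lambda>p. p)"
proof (rule pair_measure_eqI)
  show "sigma_finite_measure unif" "sigma_finite_measure unif"
    using finite_measure_unif by (simp_all add: finite_measure.axioms)
  show "sets (unif \<Otimes>\<^sub>M unif) = sets (distr (lebesgue_on (I01 \<times> I01)) borel (\<lambda>p. p))"
    by (simp add: borel_prod cong: sets_pair_measure_cong) (metis borel_prod sets_pair_measure_cong sets_unif)
  fix A B assume "A \<in> sets unif" "B \<in> sets unif"
  then have [measurable]: "A \<in> sets borel" "B \<in> sets borel" by (simp_all add: sets_unif)
  have AB: "A \<times> B \<in> sets borel" "(A \<inter> I01) \<times> (B \<inter> I01) \<in> sets borel"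
    by (intro borel_Times; measurable)+
  have "emeasure (distr (lebesgue_on (I01 \<times> I01)) borel (\<lambda>p. p)) (A \<times> B)
      = emeasure lborel ((A \<inter> I01) \<times> (B \<inter> I01))"
  proof (subst emeasure_distr[OF id_measurable_lebesgue_on])
    have "(\<lambda>x. x) -` (A \<times> B) \<inter> space (lebesgue_on (I01 \<times> I01)) = (A \<inter> I01) \<times> (B \<inter> I01)" by auto
    then show "emeasure (lebesgue_on (I01 \<times> I01)) ((\<lambda>x. x) -` (A \<times> B) \<inter> space (lebesgue_on (I01 \<times> I01)))
       = emeasure lborel ((A \<inter> I01) \<times> (B \<inter> I01))"
      using AB by (subst \<open>_ = (A \<inter> I01) \<times> (B \<inter> I01)\<close>)
        (subst emeasure_restrict_space, auto)
  qed (use AB in auto)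
  also have "\<dots> = emeasure unif A * emeasure unif B"
    by (simp add: lborel_prod[symmetric] emeasure_unif lborel.emeasure_pair_measure_Times)
  finally show "emeasure unif A * emeasure unif B
      = emeasure (distr (lebesgue_on (I01 \<times> I01)) borel (\<lambda>p. p)) (A \<times> B)" by simp
qed

lemma proj_measurable:
  assumes "u \<in> V" "v \<in> V"
  shows "(\<lambda>x. (x u, x v)) \<in> borel_measurable (PiM V (\<lambda>_. lebesgue_on I01))"
proof -
  have c: "(\<lambda>x. x w) \<in> borel_measurable (PiM V (\<lambda>_. lebesgue_on I01))" if "w \<in> V" for w
    using measurable_compose[OF measurable_component_singleton[OF that] id_measurable_lebesgue_on] .
  show ?thesis using c[OF assms(1)] c[OF assms(2)] by measurable
qed

lemma distr_PiM_pair: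
  assumes "finite V" "u \<in> V" "v \<in> V" "u \<noteq> v"
  shows "distr (PiM V (\<lambda>_. lebesgue_on I01)) borel (\<lambda>x. (x u, x v)) = unif \<Otimes>\<^sub>M unif"
proof (rule sym, rule pair_measure_eqI)
  let ?P = "PiM V (\<lambda>_. lebesgue_on I01)"
  interpret finite_measure "lebesgue_on I01" by (rule finite_measure_lebesgue_on_I01)
  interpret product_sigma_finite "\<lambda>_::'a. lebesgue_on I01" by standard
  show "sigma_finite_measure unif" "sigma_finite_measure unif"
    using finite_measure_unif by (simp_all add: finite_measure.axioms)
  show "sets (unif \<Otimes>\<^sub>M unif) = sets (distr ?P borel (\<lambda>x. (x u, x v)))"
    by (simp add: borel_prod cong: sets_pair_measure_cong) (metis borel_prod sets_pair_measure_cong sets_unif)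
  fix A B assume "A \<in> sets unif" "B \<in> sets unif"
  then have [measurable]: "A \<in> sets borel" "B \<in> sets borel" by (simp_all add: sets_unif)
  have AB: "A \<times> B \<in> sets borel" by (intro borel_Times; measurable)
  have one: "emeasure (lebesgue_on I01) I01 = 1" by (simp add: emeasure_restrict_space)
  have m: "C \<inter> I01 \<in> sets (lebesgue_on I01)" "emeasure (lebesgue_on I01) (C \<inter> I01) = emeasure unif C"
    if "C \<in> sets borel" for C
  proof -
    have "C \<inter> I01 \<in> sets borel" using that by auto
    then have "C \<inter> I01 \<in> sets lebesgue" by auto
    then show "C \<inter> I01 \<in> sets (lebesgue_on I01)"
      by (subst sets_restrict_space_iff) auto
    show "emeasure (lebesgue_on I01) (C \<inter> I01) = emeasure unif C"
      using that \<open>C \<inter> I01 \<in> sets borel\<close> by (simp add: emeasure_unif emeasure_restrict_space)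
  qed
  let ?D = "\<lambda>w. if w = u then A \<inter> I01 else if w = v then B \<inter> I01 else I01"
  have "emeasure (distr ?P borel (\<lambda>x. (x u, x v))) (A \<times> B) = emeasure ?P (PiE V ?D)"
  proof (subst emeasure_distr[OF proj_measurable[OF assms(2,3)] AB], rule arg_cong[where f = "emeasure ?P"])
    show "(\<lambda>x. (x u, x v)) -` (A \<times> B) \<inter> space ?P = PiE V ?D"
      using assms by (auto simp: space_PiM PiE_iff split: if_splits)
  qed
  also have "\<dots> = (\<Prod>w\<in>V. emeasure (lebesgue_on I01) (?D w))"
    by (rule emeasure_PiM[OF assms(1)]) (use m(1)[of A] m(1)[of B] m(1)[of I01] in auto)
  also have "\<dots> = (\<Prod>w\<in>V. (if w = u then emeasure unif A else 1) * (if w = v then emeasure unif B else 1))"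
    using assms(4) by (intro prod.cong refl) (simp add: m one)
  also have "\<dots> = emeasure unif A * emeasure unif B"
    using assms by (simp add: prod.distrib prod.delta)
  finally show "emeasure unif A * emeasure unif B
      = emeasure (distr ?P borel (\<lambda>x. (x u, x v))) (A \<times> B)" by simp
qed

lemma AE_lebesgue_on_square_imp_borel:
  assumes "AE p in lebesgue_on (I01 \<times> I01). P p"
  obtains N where "N \<in> null_sets (unif \<Otimes>\<^sub>M unif)" "\<And>p. p \<in> I01 \<times> I01 \<Longrightarrow> p \<notin> N \<Longrightarrow> P p"
proof -
  have "AE p in lebesgue. p \<in> I01 \<times> I01 \<longrightarrow> P p"
    using assms by (subst (asm) AE_restrict_space_iff) auto
  then have "AE p in lborel. p \<in> I01 \<times> I01 \<longrightarrow> P p"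
    by (simp add: AE_completion_iff)
  then obtain N where N: "{p \<in> space lborel. \<not> (p \<in> I01 \<times> I01 \<longrightarrow> P p)} \<subseteq> N"
    "emeasure lborel N = 0" "N \<in> sets lborel" by (rule AE_E)
  have "N \<in> null_sets (unif \<Otimes>\<^sub>M unif)"
  proof
    show "N \<in> sets (unif \<Otimes>\<^sub>M unif)" using N(3) unfolding pair_unif by simp
    have "emeasure (unif \<Otimes>\<^sub>M unif) N = emeasure (lebesgue_on (I01 \<times> I01)) (N \<inter> (I01 \<times> I01))"
      unfolding pair_unif using N(3) by (subst emeasure_distr[OF id_measurable_lebesgue_on]) auto
    also have "\<dots> = emeasure lborel (N \<inter> (I01 \<times> I01))"
      using N(3) by (subst emeasure_restrict_space) auto
    also have "\<dots> = 0" using N(2,3) by (meson emeasure_eq_0 inf_le1)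
    finally show "emeasure (unif \<Otimes>\<^sub>M unif) N = 0" .
  qed
  then show thesis using N(1) by (intro that) auto
qed

text \<open>The exceptional set is contained in a Borel null set of the plane, whose preimage in the cube is
null because the two coordinates are distributed like a point of the square.\<close>

lemma AE_cube_pair:
  assumes "AE p in lebesgue_on (I01 \<times> I01). P p"
    and "finite V" "u \<in> V" "v \<in> V" "u \<noteq> v"
  shows "AE x in cube V. P (x u, x v)"
proof -
  obtain N where N: "N \<in> null_sets (unif \<Otimes>\<^sub>M unif)" "\<And>p. p \<in> I01 \<times> I01 \<Longrightarrow> p \<notin> N \<Longrightarrow> P p"
    using AE_lebesgue_on_square_imp_borel[OF assms(1)] by blast
  have "AE p in distr (PiM V (\<lambda>_. lebesgue_on I01)) borel (\<lambda>x. (x u, x v)). p \<notin> N"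
    unfolding distr_PiM_pair[OF assms(2-)] using N(1) by (rule AE_not_in)
  then have "AE x in PiM V (\<lambda>_. lebesgue_on I01). (x u, x v) \<notin> N"
    by (rule AE_distrD[OF proj_measurable[OF assms(3,4)]])
  then have "AE x in PiM V (\<lambda>_. lebesgue_on I01). P (x u, x v)"
    using AE_space by eventually_elim (use assms N(2) in \<open>auto simp: space_PiM PiE_iff\<close>)
  then show ?thesis by (rule AE_completion)
qed

lemma borel_representative:
  fixes K :: "real \<times> real \<Rightarrow> real"
  assumes "K \<in> borel_measurable (lebesgue_on (I01 \<times> I01))"
  obtains K' where "K' \<in> borel_measurable borel" "AE p in lebesgue_on (I01 \<times> I01). K p = K' p"
proof -
  have "(\<lambda>p. if p \<in> I01 \<times> I01 then K p else 0) \<in> borel_measurable lebesgue"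
    using assms by (subst borel_measurable_if) auto
  then obtain g where g: "g \<in> borel_measurable lborel"
    "AE p in lborel. (if p \<in> I01 \<times> I01 then K p else 0) = g p"
    using completion_ex_borel_measurable_real by blast
  from AE_completion[OF g(2)] have "AE p in lebesgue_on (I01 \<times> I01). K p = g p"
    by (subst AE_restrict_space_iff) auto
  with g(1) show thesis by (intro that) auto
qed

lemma borel_measurable_completion_AE_cong:
  fixes f g :: "'a \<Rightarrow> real"
  assumes f: "f \<in> borel_measurable (completion M)" and ae: "AE x in completion M. f x = g x"
  shows "g \<in> borel_measurable (completion M)"
proof (rule measurableI)
  fix A :: "real set" assume A: "A \<in> sets borel"
  show "g -` A \<inter> space (completion M) \<in> sets (completion M)"
  proof (rule completion.in_sets_AE)
    show "AE x in completion M. (x \<in> f -` A \<inter> space (completion M)) = (x \<in> g -` A \<inter> space (completion M))"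
      using ae by eventually_elim auto
    show "f -` A \<inter> space (completion M) \<in> sets (completion M)"
      using f A by (rule measurable_sets)
  qed auto
qed simp

text \<open>The preimage of a Lebesgue measurable set under the projection need not lie in the product
sigma-algebra of the cube. It differs from the preimage of a Borel set by a null set, so that
completing the product measure is enough.\<close>

lemma cube_pair_measurable:
  fixes K :: "real \<times> real \<Rightarrow> real"
  assumes K: "K \<in> borel_measurable (lebesgue_on (I01 \<times> I01))"
    and V: "finite V" "u \<in> V" "v \<in> V" "u \<noteq> v"
  shows "(\<lambda>x. K (x u, x v)) \<in> borel_measurable (cube V)"
proof -
  obtain K' where K': "K' \<in> borel_measurable borel" "AE p in lebesgue_on (I01 \<times> I01). K p = K' p"
    using borel_representative[OF K] by blast
  have "(\<lambda>x. K' (x u, x v)) \<in> borel_measurable (cube V)"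
    by (rule measurable_completion, rule measurable_compose[OF proj_measurable[OF V(2,3)] K'(1)])
  moreover have "AE x in cube V. K' (x u, x v) = K (x u, x v)"
    using AE_cube_pair[OF K'(2) V] by eventually_elim simp
  ultimately show ?thesis
    by (rule borel_measurable_completion_AE_cong)
qed

section \<open>The Sidorenko inequality for one-subdivisions over finite probability spaces\<close>

lemma sum_PiE_insert:
  fixes f :: "('v \<Rightarrow> 'x) \<Rightarrow> real"
  assumes "w \<notin> V"
  shows "(\<Sum>a\<in>PiE (insert w V) (\<lambda>_. X). f a) = (\<Sum>y\<in>X. \<Sum>a\<in>PiE V (\<lambda>_. X). f (a(w := y)))"
proof -
  have "inj_on (\<lambda>(y, a). a(w := y)) (X \<times> PiE V (\<lambda>_. X))"
    using inj_combinator[OF assms, of "\<lambda>_. X"] .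
  then have "(\<Sum>a\<in>PiE (insert w V) (\<lambda>_. X). f a)
      = (\<Sum>p\<in>X \<times> PiE V (\<lambda>_. X). f ((\<lambda>(y, a). a(w := y)) p))"
    unfolding PiE_insert_eq by (subst sum.reindex) auto
  then show ?thesis by (simp add: sum.cartesian_product case_prod_beta)
qed

text \<open>Summing over the image of a point outside \<open>U\<close> contributes the total mass \<open>1\<close>. This removes
isolated vertices, for which the comparison of measures in \<open>finite_sidorenko_up_to_constant\<close> would
fail pointwise.\<close>

lemma sum_PiE_isolated:
  fixes \<mu> :: "'x \<Rightarrow> real" and g :: "('v \<Rightarrow> 'x) \<Rightarrow> real"
  assumes "finite V" "U \<subseteq> V" "(\<Sum>x\<in>X. \<mu> x) = 1"
    and g: "\<And>a b. (\<And>v. v \<in> U \<Longrightarrow> a v = b v) \<Longrightarrow> g a = g b"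
  shows "(\<Sum>a\<in>PiE V (\<lambda>_. X). (\<Prod>v\<in>V. \<mu> (a v)) * g a)
       = (\<Sum>a\<in>PiE U (\<lambda>_. X). (\<Prod>v\<in>U. \<mu> (a v)) * g a)"
proof -
  have "finite W \<Longrightarrow> W \<inter> U = {} \<Longrightarrow>
      (\<Sum>a\<in>PiE (W \<union> U) (\<lambda>_. X). (\<Prod>v\<in>W \<union> U. \<mu> (a v)) * g a)
       = (\<Sum>a\<in>PiE U (\<lambda>_. X). (\<Prod>v\<in>U. \<mu> (a v)) * g a)" for W
  proof (induction W rule: finite_induct)
    case (insert w W)
    have fin: "finite (W \<union> U)" using insert.hyps assms(1,2) finite_subset by blast
    have w: "w \<notin> W \<union> U" using insert by auto
    have "(\<Sum>a\<in>PiE (insert w W \<union> U) (\<lambda>_. X). (\<Prod>v\<in>insert w W \<union> U. \<mu> (a v)) * g a)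
        = (\<Sum>y\<in>X. \<Sum>a\<in>PiE (W \<union> U) (\<lambda>_. X). (\<Prod>v\<in>insert w (W \<union> U). \<mu> ((a(w := y)) v)) * g (a(w := y)))"
      using sum_PiE_insert[OF w, of "\<lambda>a. (\<Prod>v\<in>insert w (W \<union> U). \<mu> (a v)) * g a"] by simp
    also have "\<dots> = (\<Sum>y\<in>X. \<Sum>a\<in>PiE (W \<union> U) (\<lambda>_. X). \<mu> y * ((\<Prod>v\<in>W \<union> U. \<mu> (a v)) * g a))"
    proof (intro sum.cong refl)
      fix y a
      have "(\<Prod>v\<in>W \<union> U. \<mu> ((a(w := y)) v)) = (\<Prod>v\<in>W \<union> U. \<mu> (a v))"
        using w by (intro prod.cong) auto
      moreover have "g (a(w := y)) = g a" using w by (intro g) auto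
      ultimately show "(\<Prod>v\<in>insert w (W \<union> U). \<mu> ((a(w := y)) v)) * g (a(w := y))
          = \<mu> y * ((\<Prod>v\<in>W \<union> U. \<mu> (a v)) * g a)"
        using w fin by simp
    qed
    also have "\<dots> = (\<Sum>a\<in>PiE (W \<union> U) (\<lambda>_. X). (\<Prod>v\<in>W \<union> U. \<mu> (a v)) * g a)"
      by (simp add: sum_distrib_left[symmetric] sum_distrib_right[symmetric] assms(3))
    also have "\<dots> = (\<Sum>a\<in>PiE U (\<lambda>_. X). (\<Prod>v\<in>U. \<mu> (a v)) * g a)" using insert by auto
    finally show ?case .
  qed simp
  from this[of "V - U"] assms(1,2) show ?thesis
    by (simp add: Un_absorb2 Diff_disjoint Int_commute)
qed

text \<open>Each vertex of the left product occurs as an end of some edge, and the surplus factors on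
the right are at least \<open>1\<close>.\<close>

lemma prod_covered_le_prod_edges:
  fixes b :: "'v \<Rightarrow> real"
  assumes "finite E" "\<And>v. v \<in> h ` E \<union> t ` E \<Longrightarrow> 1 \<le> b v"
  shows "(\<Prod>v\<in>h ` E \<union> t ` E. b v) \<le> (\<Prod>e\<in>E. b (h e) * b (t e))"
  using assms
proof (induction E rule: finite_induct)
  case (insert e E)
  define U where "U = h ` E \<union> t ` E"
  have fin: "finite U" using insert.hyps by (simp add: U_def)
  have U1: "1 \<le> b v" if "v \<in> U" for v using insert.prems that by (auto simp: U_def)
  have he: "1 \<le> b (h e)" "1 \<le> b (t e)" using insert.prems by auto
  have ins: "(\<Prod>v\<in>insert w S. b v) \<le> b w * (\<Prod>v\<in>S. b v)"
    if "finite S" "1 \<le> b w" "\<And>v. v \<in> S \<Longrightarrow> 1 \<le> b v" for w S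
  proof (cases "w \<in> S")
    case True
    have "0 \<le> (\<Prod>v\<in>S. b v)" by (rule prod_nonneg) (use that(3) in force)
    then show ?thesis using True that(2) by (simp add: insert_absorb mult_le_cancel_right1)
  qed (use that in simp)
  have "(\<Prod>v\<in>h ` insert e E \<union> t ` insert e E. b v) = (\<Prod>v\<in>insert (h e) (insert (t e) U). b v)"
    by (rule arg_cong[where f = "prod b"]) (auto simp: U_def)
  also have "\<dots> \<le> b (h e) * (\<Prod>v\<in>insert (t e) U. b v)"
    by (rule ins) (use fin he U1 in auto)
  also have "\<dots> \<le> b (h e) * (b (t e) * (\<Prod>v\<in>U. b v))"
    by (intro mult_left_mono ins) (use fin he U1 in auto)
  also have "\<dots> \<le> b (h e) * (b (t e) * (\<Prod>e\<in>E. b (h e) * b (t e)))"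
    using insert.IH insert.prems he order.trans[OF zero_le_one]
    by (intro mult_left_mono) (auto simp: U_def)
  also have "\<dots> = (\<Prod>e\<in>insert e E. b (h e) * b (t e))" using insert.hyps by simp
  finally show ?case .
qed simp

text \<open>The matrix \<open>M\<^sup>T D M\<close>, where \<open>D\<close> is the diagonal matrix of the weights: the weighted number
of paths of length two, the finite form of \<open>W \<circ> W\<close>.\<close>

definition codegree :: "'x set \<Rightarrow> ('x \<Rightarrow> real) \<Rightarrow> ('x \<Rightarrow> 'x \<Rightarrow> real) \<Rightarrow> 'x \<Rightarrow> 'x \<Rightarrow> real" where
  "codegree X \<mu> M x y = (\<Sum>z\<in>X. \<mu> z * (M z x * M z y))"

text \<open>The homomorphism density \<open>t(H, K)\<close> over a finite weighted space \<open>(X, \<mu>)\<close>. Edges are oriented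
arbitrarily from \<open>h e\<close> to \<open>t e\<close>.\<close>

definition weighted_density :: "'v set \<Rightarrow> 'e set \<Rightarrow> ('e \<Rightarrow> 'v) \<Rightarrow> ('e \<Rightarrow> 'v) \<Rightarrow>
    'x set \<Rightarrow> ('x \<Rightarrow> real) \<Rightarrow> ('x \<Rightarrow> 'x \<Rightarrow> real) \<Rightarrow> real" where
  "weighted_density V E h t X \<mu> K = (\<Sum>a\<in>PiE V (\<lambda>_. X). (\<Prod>v\<in>V. \<mu> (a v)) * (\<Prod>e\<in>E. K (a (h e)) (a (t e))))"

definition weighting :: "'x set \<Rightarrow> ('x \<Rightarrow> real) \<Rightarrow> bool" where
  "weighting X \<mu> \<longleftrightarrow> finite X \<and> (\<forall>x\<in>X. 0 < \<mu> x) \<and> (\<Sum>x\<in>X. \<mu> x) = 1"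

definition symmetric_nonneg :: "'x set \<Rightarrow> ('x \<Rightarrow> 'x \<Rightarrow> real) \<Rightarrow> bool" where
  "symmetric_nonneg X M \<longleftrightarrow> (\<forall>x\<in>X. \<forall>y\<in>X. 0 \<le> M x y \<and> M x y = M y x)"

text \<open>The regular-KNRS property over finite probability spaces, normalised to \<open>\<rho> = 1\<close>. By homogeneity
the entries of \<open>K\<close> may then be arbitrarily large. In the density condition \<open>b x\<close> stands for the measure of
the part of a set that lies in the cell of \<open>x\<close>. The space consists of natural numbers because a
definition cannot quantify over types.\<close>

definition finite_regular_KNRS :: "'v set \<Rightarrow> 'e set \<Rightarrow> ('e \<Rightarrow> 'v) \<Rightarrow> ('e \<Rightarrow> 'v) \<Rightarrow> bool" where
  "finite_regular_KNRS V E h t \<longleftrightarrow> (\<forall>(A :: nat set) \<alpha> K.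
     weighting A \<alpha> \<longrightarrow> symmetric_nonneg A K \<longrightarrow> (\<forall>x\<in>A. (\<Sum>y\<in>A. K x y * \<alpha> y) = 1) \<longrightarrow>
     (\<forall>b. (\<Sum>x\<in>A. b x)\<^sup>2 \<le> (\<Sum>x\<in>A. \<Sum>y\<in>A. b x * b y * K x y)) \<longrightarrow>
     1 \<le> weighted_density V E h t A \<alpha> K)"

lemma weighted_density_isolated:
  assumes "finite V" "finite E" "h ` E \<subseteq> V" "t ` E \<subseteq> V" "weighting X \<mu>"
  shows "weighted_density V E h t X \<mu> K = weighted_density (h ` E \<union> t ` E) E h t X \<mu> K"
  unfolding weighted_density_def
proof (rule sum_PiE_isolated)
  fix a b :: "'a \<Rightarrow> 'c" assume "\<And>v. v \<in> h ` E \<union> t ` E \<Longrightarrow> a v = b v"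
  then show "(\<Prod>e\<in>E. K (a (h e)) (a (t e))) = (\<Prod>e\<in>E. K (b (h e)) (b (t e)))"
    by (intro prod.cong) auto
qed (use assms in \<open>auto simp: weighting_def\<close>)

text \<open>Writing \<open>c z = (\<Sum>x\<in>A. N z x * b x)\<close>, the right-hand side is the mean of \<open>c\<^sup>2\<close> and the sum of \<open>b\<close> is the mean
of \<open>c\<close>, because \<open>N\<close> is regular; the difference is a variance.\<close>

lemma codegree_dense:
  assumes "weighting A \<alpha>" "\<And>z. z \<in> A \<Longrightarrow> (\<Sum>x\<in>A. N z x * \<alpha> x) = 1"
    and sym: "symmetric_nonneg A N"
  shows "(\<Sum>x\<in>A. b x)\<^sup>2 \<le> (\<Sum>x\<in>A. \<Sum>y\<in>A. b x * b y * codegree A \<alpha> N x y)"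
proof -
  define c where "c = (\<lambda>z. \<Sum>x\<in>A. N z x * b x)"
  have fin: "finite A" and pos: "\<And>x. x \<in> A \<Longrightarrow> 0 < \<alpha> x" and one: "(\<Sum>x\<in>A. \<alpha> x) = 1"
    using assms(1) by (auto simp: weighting_def)
  have "(\<Sum>z\<in>A. \<alpha> z * c z) = (\<Sum>x\<in>A. \<Sum>z\<in>A. \<alpha> z * (N z x * b x))"
    unfolding c_def sum_distrib_left by (rule sum.swap)
  also have "\<dots> = (\<Sum>x\<in>A. b x * (\<Sum>z\<in>A. N x z * \<alpha> z))"
    unfolding sum_distrib_left using sym by (intro sum.cong refl) (auto simp: symmetric_nonneg_def mult_ac)
  also have "\<dots> = (\<Sum>x\<in>A. b x)" using assms(2) by simp
  finally have c: "(\<Sum>z\<in>A. \<alpha> z * c z) = (\<Sum>x\<in>A. b x)" .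
  define B where "B = (\<Sum>x\<in>A. b x)"
  have "0 \<le> (\<Sum>z\<in>A. \<alpha> z * (c z - B)\<^sup>2)"
    using pos by (intro sum_nonneg mult_nonneg_nonneg) (auto intro: less_imp_le)
  also have "\<dots> = (\<Sum>z\<in>A. \<alpha> z * (c z)\<^sup>2) - 2 * B * (\<Sum>z\<in>A. \<alpha> z * c z) + B\<^sup>2 * (\<Sum>z\<in>A. \<alpha> z)"
    unfolding sum_distrib_left by (simp add: sum.distrib[symmetric] sum_subtractf[symmetric])
      (intro sum.cong refl, simp add: power2_eq_square algebra_simps)
  also have "\<dots> = (\<Sum>z\<in>A. \<alpha> z * (c z)\<^sup>2) - B\<^sup>2"
    by (simp add: c one B_def[symmetric] power2_eq_square)
  finally have "(\<Sum>x\<in>A. b x)\<^sup>2 \<le> (\<Sum>z\<in>A. \<alpha> z * (c z)\<^sup>2)" by (simp add: B_def)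
  also have "\<dots> = (\<Sum>z\<in>A. \<Sum>x\<in>A. \<Sum>y\<in>A. b x * b y * (\<alpha> z * (N z x * N z y)))"
    unfolding c_def power2_eq_square sum_product sum_distrib_left
    by (intro sum.cong refl) (simp add: sum_distrib_left mult_ac)
  also have "\<dots> = (\<Sum>x\<in>A. \<Sum>z\<in>A. \<Sum>y\<in>A. b x * b y * (\<alpha> z * (N z x * N z y)))"
    by (rule sum.swap)
  also have "\<dots> = (\<Sum>x\<in>A. \<Sum>y\<in>A. \<Sum>z\<in>A. b x * b y * (\<alpha> z * (N z x * N z y)))"
    by (intro sum.cong refl sum.swap)
  also have "\<dots> = (\<Sum>x\<in>A. \<Sum>y\<in>A. b x * b y * codegree A \<alpha> N x y)"
    by (simp add: codegree_def sum_distrib_left)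
  finally show ?thesis .
qed

text \<open>A product of regular matrices is regular.\<close>

lemma codegree_row_sum:
  assumes "\<And>z. z \<in> A \<Longrightarrow> (\<Sum>x\<in>A. N z x * \<alpha> x) = 1" "symmetric_nonneg A N" "x \<in> A"
  shows "(\<Sum>y\<in>A. codegree A \<alpha> N x y * \<alpha> y) = 1"
proof -
  have "(\<Sum>y\<in>A. codegree A \<alpha> N x y * \<alpha> y) = (\<Sum>z\<in>A. \<Sum>y\<in>A. \<alpha> z * (N z x * N z y) * \<alpha> y)"
    unfolding codegree_def sum_distrib_right by (rule sum.swap)
  also have "\<dots> = (\<Sum>z\<in>A. \<alpha> z * N z x * (\<Sum>y\<in>A. N z y * \<alpha> y))"
    by (simp add: sum_distrib_left mult_ac)
  also have "\<dots> = (\<Sum>z\<in>A. N x z * \<alpha> z)"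
    using assms by (intro sum.cong) (auto simp: symmetric_nonneg_def mult_ac)
  finally show ?thesis using assms by simp
qed

lemma weighted_density_codegree_regular:
  assumes "finite_regular_KNRS V E h t" "weighting (A :: nat set) \<alpha>" "symmetric_nonneg A N"
    and "\<And>z. z \<in> A \<Longrightarrow> (\<Sum>x\<in>A. N z x * \<alpha> x) = 1"
  shows "1 \<le> weighted_density V E h t A \<alpha> (codegree A \<alpha> N)"
proof -
  have "symmetric_nonneg A (codegree A \<alpha> N)"
    unfolding symmetric_nonneg_def
  proof (intro ballI conjI)
    fix x y assume "x \<in> A" "y \<in> A"
    then show "0 \<le> codegree A \<alpha> N x y"
      using assms(2,3) unfolding codegree_def symmetric_nonneg_def weighting_def
      by (intro sum_nonneg mult_nonneg_nonneg) (auto intro: less_imp_le)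
  qed (simp add: codegree_def mult.commute)
  then show ?thesis
    using assms(1)[unfolded finite_regular_KNRS_def, rule_format, OF assms(2), of "codegree A \<alpha> N"]
      codegree_row_sum[OF assms(4,3)] codegree_dense[OF assms(2,4,3)] by blast
qed

text \<open>A subset of at least half the mass and with large minimum degree. It is found by maximising
\<open>\<pi>(A \<times> A) - \<mu>(A) / 2\<close>: comparison with \<open>X\<close> bounds the mass from below, and comparison with \<open>A - {x}\<close> bounds
the degree of \<open>x\<close> in \<open>A\<close>.\<close>

lemma heavy_subset:
  fixes \<pi> :: "'x \<Rightarrow> 'x \<Rightarrow> real"
  assumes "weighting X \<mu>" "symmetric_nonneg X \<pi>" "(\<Sum>x\<in>X. \<Sum>y\<in>X. \<pi> x y) = 1"
  obtains A where "A \<subseteq> X" "1/2 \<le> (\<Sum>x\<in>A. \<Sum>y\<in>A. \<pi> x y)"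
    "\<And>x. x \<in> A \<Longrightarrow> \<mu> x / 4 \<le> (\<Sum>y\<in>A. \<pi> x y)"
proof -
  define f where "f = (\<lambda>A. (\<Sum>x\<in>A. \<Sum>y\<in>A. \<pi> x y) - (\<Sum>x\<in>A. \<mu> x) / 2)"
  have fin: "finite X" and pos: "\<And>x. x \<in> X \<Longrightarrow> 0 < \<mu> x" and one: "(\<Sum>x\<in>X. \<mu> x) = 1"
    using assms(1) by (auto simp: weighting_def)
  have "finite (Pow X)" "Pow X \<noteq> {}" using fin by auto
  then obtain A where A: "A \<in> Pow X" "\<And>B. B \<in> Pow X \<Longrightarrow> f B \<le> f A"
    using obtains_MAX[of "Pow X" f] by (metis Max_ge finite_imageI image_eqI)
  have finA: "finite A" using A fin finite_subset by auto
  show thesis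
  proof (rule that)
    show "A \<subseteq> X" using A by auto
    have "f X \<le> f A" using A by auto
    moreover have "0 \<le> (\<Sum>x\<in>A. \<mu> x)" using A pos by (intro sum_nonneg) (auto intro: less_imp_le)
    ultimately show "1/2 \<le> (\<Sum>x\<in>A. \<Sum>y\<in>A. \<pi> x y)"
      by (simp add: f_def assms(3) one)
    fix x assume x: "x \<in> A"
    let ?B = "A - {x}"
    have sw: "(\<Sum>y\<in>?B. \<pi> y x) = (\<Sum>y\<in>?B. \<pi> x y)"
      using assms(2) A x by (intro sum.cong) (auto simp: symmetric_nonneg_def)
    have row: "(\<Sum>y\<in>A. \<pi> x y) = \<pi> x x + (\<Sum>y\<in>?B. \<pi> x y)"
      using x finA by (simp add: sum.remove[of A x])
    have "(\<Sum>x\<in>A. \<Sum>y\<in>A. \<pi> x y) = (\<Sum>y\<in>A. \<pi> x y) + (\<Sum>z\<in>?B. \<Sum>y\<in>A. \<pi> z y)"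
      using x finA by (simp add: sum.remove[of A x])
    also have "(\<Sum>z\<in>?B. \<Sum>y\<in>A. \<pi> z y) = (\<Sum>z\<in>?B. \<pi> z x + (\<Sum>y\<in>?B. \<pi> z y))"
      using x finA by (simp add: sum.remove[of A x])
    also have "\<dots> = (\<Sum>y\<in>?B. \<pi> x y) + (\<Sum>z\<in>?B. \<Sum>y\<in>?B. \<pi> z y)"
      by (simp add: sum.distrib sw)
    finally have "(\<Sum>x\<in>A. \<Sum>y\<in>A. \<pi> x y)
        = 2 * (\<Sum>y\<in>A. \<pi> x y) - \<pi> x x + (\<Sum>z\<in>?B. \<Sum>y\<in>?B. \<pi> z y)"
      using row by simp
    moreover have "(\<Sum>x\<in>A. \<mu> x) = \<mu> x + (\<Sum>x\<in>?B. \<mu> x)" using x finA by (simp add: sum.remove[of A x])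
    moreover have "f ?B \<le> f A" using A by (metis Diff_subset Pow_iff order.trans)
    moreover have "0 \<le> \<pi> x x" using assms(2) A x by (auto simp: symmetric_nonneg_def)
    ultimately show "\<mu> x / 4 \<le> (\<Sum>y\<in>A. \<pi> x y)" unfolding f_def by (simp add: field_simps)
  qed
qed

text \<open>The reduction to regular matrices. With the edge measure \<open>\<pi>\<close> of total mass \<open>1\<close>, restrict to a heavy
subset \<open>A\<close>, let \<open>\<alpha>\<close> be the normalised degree on \<open>A\<close> and let \<open>N\<close> be the density of \<open>\<pi>\<close>, normalised to mass
\<open>1\<close> on \<open>A \<times> A\<close>, with respect to \<open>\<alpha> \<times> \<alpha>\<close>. The marginals of \<open>\<pi>\<close> on \<open>A\<close> are proportional to \<open>\<alpha>\<close>, so that \<open>N\<close> is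
regular and the regular-KNRS property gives density at least \<open>1\<close> for its codegree matrix. Passing back to \<open>\<mu>\<close> and \<open>M\<close>
introduces one factor \<open>r = \<alpha> / \<mu>\<close> for each half-edge; one such factor per vertex turns \<open>\<mu>\<close> into \<open>\<alpha>\<close>, and
the remaining ones are at least \<open>1/4\<close>.\<close>

lemma finite_sidorenko_up_to_constant:
  assumes KNRS: "finite_regular_KNRS V E h t"
    and graph: "finite V" "finite E" "h ` E \<subseteq> V" "t ` E \<subseteq> V"
    and X: "weighting (X :: nat set) \<mu>" and M: "symmetric_nonneg X M"
  shows "(1/256) ^ card E * (\<Sum>x\<in>X. \<Sum>y\<in>X. \<mu> x * \<mu> y * M x y) ^ (2 * card E)
       \<le> weighted_density V E h t X \<mu> (codegree X \<mu> M)"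
proof -
  define p where "p = (\<Sum>x\<in>X. \<Sum>y\<in>X. \<mu> x * \<mu> y * M x y)"
  define U where "U = h ` E \<union> t ` E"
  have hU: "h e \<in> U" "t e \<in> U" if "e \<in> E" for e using that by (auto simp: U_def)
  have fin: "finite X" and pos: "\<And>x. x \<in> X \<Longrightarrow> 0 < \<mu> x" and one: "(\<Sum>x\<in>X. \<mu> x) = 1"
    using X by (auto simp: weighting_def)
  have M0: "\<And>x y. x \<in> X \<Longrightarrow> y \<in> X \<Longrightarrow> 0 \<le> M x y" using M by (auto simp: symmetric_nonneg_def)
  have M_sym: "\<And>x y. x \<in> X \<Longrightarrow> y \<in> X \<Longrightarrow> M x y = M y x" using M by (auto simp: symmetric_nonneg_def)
  have p0: "0 \<le> p" unfolding p_def
    using pos M0 by (intro sum_nonneg mult_nonneg_nonneg) (auto intro: less_imp_le)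
  have C0: "0 \<le> codegree X \<mu> M x y" if "x \<in> X" "y \<in> X" for x y
    unfolding codegree_def using that pos M0
    by (intro sum_nonneg mult_nonneg_nonneg) (auto intro: less_imp_le)
  have T_U: "weighted_density V E h t X \<mu> (codegree X \<mu> M) = weighted_density U E h t X \<mu> (codegree X \<mu> M)"
    unfolding U_def by (rule weighted_density_isolated[OF graph X])
  consider "p = 0" "E = {}" | "p = 0" "E \<noteq> {}" | "0 < p" using p0 by linarith
  then show ?thesis
  proof cases
    case 1
    then show ?thesis unfolding T_U by (simp add: U_def weighted_density_def)
  next
    case 2
    have "0 \<le> weighted_density V E h t X \<mu> (codegree X \<mu> M)"
      unfolding weighted_density_def using graph(3,4)
      by (intro sum_nonneg mult_nonneg_nonneg prod_nonneg)
        (auto simp: PiE_iff image_subset_iff intro!: less_imp_le[OF pos] C0)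
    moreover have "card E \<noteq> 0" using 2 graph by simp
    ultimately show ?thesis using 2 by (simp add: p_def[symmetric] power_0_left)
  next
    case 3
    define \<pi> where "\<pi> = (\<lambda>x y. \<mu> x * \<mu> y * M x y / p)"
    have \<pi>: "symmetric_nonneg X \<pi>"
      using pos M0 M_sym p0 by (auto simp: symmetric_nonneg_def \<pi>_def less_imp_le)
    have "(\<Sum>x\<in>X. \<Sum>y\<in>X. \<pi> x y) = 1"
      using 3 by (simp add: \<pi>_def sum_divide_distrib[symmetric] p_def[symmetric])
    from heavy_subset[OF X \<pi> this] obtain A where A: "A \<subseteq> X" "1/2 \<le> (\<Sum>x\<in>A. \<Sum>y\<in>A. \<pi> x y)"
      "\<And>x. x \<in> A \<Longrightarrow> \<mu> x / 4 \<le> (\<Sum>y\<in>A. \<pi> x y)" by blast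
    define d where "d = (\<lambda>x. \<Sum>y\<in>A. \<pi> x y)"
    define q where "q = (\<Sum>x\<in>A. d x)"
    define \<alpha> where "\<alpha> = (\<lambda>x. d x / q)"
    define N where "N = (\<lambda>x y. \<pi> x y / (q * \<alpha> x * \<alpha> y))"
    define r where "r = (\<lambda>x. \<alpha> x / \<mu> x)"
    have finA: "finite A" using A(1) fin finite_subset by blast
    have AX: "x \<in> X" if "x \<in> A" for x using that A by auto
    have \<pi>0: "0 \<le> \<pi> x y" if "x \<in> X" "y \<in> X" for x y using \<pi> that by (auto simp: symmetric_nonneg_def)
    have q2: "1/2 \<le> q" using A(2) by (simp add: q_def d_def)
    have q1: "q \<le> 1"
    proof -
      have "q \<le> (\<Sum>x\<in>A. \<Sum>y\<in>X. \<pi> x y)"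
        unfolding q_def d_def using A(1) fin \<pi>0 by (intro sum_mono sum_mono2) auto
      also have "\<dots> \<le> (\<Sum>x\<in>X. \<Sum>y\<in>X. \<pi> x y)"
        using A(1) fin \<pi>0 by (intro sum_mono2 sum_nonneg) auto
      finally show ?thesis using \<open>(\<Sum>x\<in>X. \<Sum>y\<in>X. \<pi> x y) = 1\<close> by simp
    qed
    have d_ge: "\<mu> x / 4 \<le> d x" if "x \<in> A" for x using A(3)[OF that] by (simp add: d_def)
    have d0: "0 < d x" if "x \<in> A" for x using d_ge[OF that] pos[OF AX[OF that]] by linarith
    have \<alpha>0: "0 < \<alpha> x" if "x \<in> A" for x using d0[OF that] q2 by (simp add: \<alpha>_def)
    have "d x \<le> \<alpha> x" if "x \<in> A" for x using d0[OF that] q1 q2 by (simp add: \<alpha>_def field_simps)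
    then have r4: "1/4 \<le> r x" if "x \<in> A" for x
      using d_ge[OF that] pos[OF AX[OF that]] that by (force simp: r_def field_simps)
    have W: "weighting A \<alpha>"
      using finA \<alpha>0 q2 by (auto simp: weighting_def \<alpha>_def sum_divide_distrib[symmetric] q_def)
    have N: "symmetric_nonneg A N"
      using \<pi> AX \<alpha>0 q2 by (auto simp: symmetric_nonneg_def N_def mult_ac less_imp_le)
    have N0: "0 \<le> N x y" if "x \<in> A" "y \<in> A" for x y using N that by (auto simp: symmetric_nonneg_def)
    have Nrow: "(\<Sum>x\<in>A. N z x * \<alpha> x) = 1" if "z \<in> A" for z
    proof -
      have "(\<Sum>x\<in>A. N z x * \<alpha> x) = (\<Sum>x\<in>A. \<pi> z x / d z)"
        using \<alpha>0 q2 that by (intro sum.cong) (auto simp: N_def \<alpha>_def field_simps dest: d0)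
      also have "\<dots> = 1" using d0[OF that] by (simp add: sum_divide_distrib[symmetric]) (simp add: d_def)
      finally show ?thesis .
    qed
    \<comment> \<open>The constant \<open>1/16\<close> is \<open>q\<^sup>2 * r z\<close> bounded below by \<open>1/4 * 1/4\<close>.\<close>
    have cod: "p\<^sup>2 / 16 * (r x * r y) * codegree A \<alpha> N x y \<le> codegree X \<mu> M x y" if xy: "x \<in> A" "y \<in> A" for x y
    proof -
      have "p\<^sup>2 / 16 * (r x * r y) * codegree A \<alpha> N x y
          = (\<Sum>z\<in>A. p\<^sup>2 / 16 * (\<alpha> z * (r x * N z x) * (r y * N z y)))"
        unfolding codegree_def sum_distrib_left by (simp add: mult_ac)
      also have "\<dots> \<le> (\<Sum>z\<in>A. \<mu> z * (M z x * M z y))"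
      proof (rule sum_mono)
        fix z assume z: "z \<in> A"
        have eq: "M z w = p * q * r z * (r w * N z w)" if "w \<in> A" for w
          using \<alpha>0[OF z] \<alpha>0[OF that] q2 pos[OF AX[OF z]] pos[OF AX[OF that]] 3
          by (simp add: N_def r_def \<pi>_def field_simps)
        have "\<mu> z * r z = \<alpha> z" using pos[OF AX[OF z]] by (simp add: r_def)
        then have "\<mu> z * (M z x * M z y) = (p\<^sup>2 * (\<alpha> z * (r x * N z x) * (r y * N z y))) * (q\<^sup>2 * r z)"
          unfolding eq[OF xy(1)] eq[OF xy(2)] by (simp add: power2_eq_square algebra_simps)
        moreover have "1/4 * (1/4) \<le> q\<^sup>2 * r z"
        proof (rule mult_mono)
          show "1/4 \<le> q\<^sup>2" using power_mono[OF q2, of 2] by (simp add: power2_eq_square)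
        qed (use r4[OF z] in auto)
        moreover have "0 \<le> p\<^sup>2 * (\<alpha> z * (r x * N z x) * (r y * N z y))"
          using \<alpha>0[OF z] r4[OF xy(1)] r4[OF xy(2)] N0[OF z xy(1)] N0[OF z xy(2)]
          by (intro mult_nonneg_nonneg) auto
        ultimately show "p\<^sup>2 / 16 * (\<alpha> z * (r x * N z x) * (r y * N z y)) \<le> \<mu> z * (M z x * M z y)"
          using mult_left_mono[of "1/4 * (1/4)" "q\<^sup>2 * r z" "p\<^sup>2 * (\<alpha> z * (r x * N z x) * (r y * N z y))"]
          by simp
      qed
      also have "\<dots> \<le> codegree X \<mu> M x y" unfolding codegree_def
        using A(1) fin pos M0 xy by (intro sum_mono2 mult_nonneg_nonneg) (auto intro: less_imp_le)
      finally show ?thesis .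
    qed
    have K0: "0 \<le> codegree A \<alpha> N x y" if "x \<in> A" "y \<in> A" for x y
      unfolding codegree_def using that \<alpha>0 N0
      by (intro sum_nonneg mult_nonneg_nonneg) (auto intro: less_imp_le)
    have "1 \<le> weighted_density V E h t A \<alpha> (codegree A \<alpha> N)"
      using weighted_density_codegree_regular[OF KNRS W N Nrow] by simp
    also have "\<dots> = weighted_density U E h t A \<alpha> (codegree A \<alpha> N)"
      unfolding U_def by (rule weighted_density_isolated[OF graph W])
    \<comment> \<open>Each edge loses \<open>1/16\<close> at its middle vertex by \<open>cod\<close> and \<open>1/4\<close> at each of its two half-edges.\<close>
    finally have "(p\<^sup>2 / 256) ^ card E * 1 \<le> (p\<^sup>2 / 256) ^ card E * weighted_density U E h t A \<alpha> (codegree A \<alpha> N)"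
      by (intro mult_left_mono) auto
    also have "\<dots> \<le> (\<Sum>a\<in>PiE U (\<lambda>_. A). (\<Prod>v\<in>U. \<mu> (a v)) * (\<Prod>e\<in>E. codegree X \<mu> M (a (h e)) (a (t e))))"
      unfolding weighted_density_def sum_distrib_left
    proof (rule sum_mono)
      fix a assume a: "a \<in> PiE U (\<lambda>_. A)"
      have aA: "a v \<in> A" if "v \<in> U" for v using a that by auto
      have aE: "a (h e) \<in> A" "a (t e) \<in> A" if "e \<in> E" for e using hU[OF that] aA by auto
      have r0: "0 < r (a v)" if "v \<in> U" for v using r4[OF aA[OF that]] by linarith
      let ?k = "\<lambda>e. codegree A \<alpha> N (a (h e)) (a (t e))"
      have "(\<Prod>v\<in>U. r (a v)) \<le> (\<Prod>v\<in>U. 4 * r (a v))"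
        by (intro prod_mono) (use r0 in force)
      also have "\<dots> \<le> (\<Prod>e\<in>E. 4 * r (a (h e)) * (4 * r (a (t e))))"
        unfolding U_def
        by (rule prod_covered_le_prod_edges[OF graph(2)]) (use r4 aA in \<open>force simp: U_def\<close>)
      finally have rr: "(\<Prod>v\<in>U. r (a v)) \<le> (\<Prod>e\<in>E. 16 * (r (a (h e)) * r (a (t e))))"
        by (simp add: mult_ac)
      have "(\<Prod>v\<in>U. \<alpha> (a v)) = (\<Prod>v\<in>U. \<mu> (a v)) * (\<Prod>v\<in>U. r (a v))"
        unfolding prod.distrib[symmetric]
        by (intro prod.cong refl) (use pos AX aA in \<open>force simp: r_def\<close>)
      also have "\<dots> \<le> (\<Prod>v\<in>U. \<mu> (a v)) * (\<Prod>e\<in>E. 16 * (r (a (h e)) * r (a (t e))))"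
        by (intro mult_left_mono rr prod_nonneg) (use pos AX aA in \<open>auto intro: less_imp_le\<close>)
      finally have "(p\<^sup>2 / 256) ^ card E * ((\<Prod>v\<in>U. \<alpha> (a v)) * (\<Prod>e\<in>E. ?k e))
          \<le> (p\<^sup>2 / 256) ^ card E * (((\<Prod>v\<in>U. \<mu> (a v)) * (\<Prod>e\<in>E. 16 * (r (a (h e)) * r (a (t e))))) * (\<Prod>e\<in>E. ?k e))"
        using K0 aE by (intro mult_left_mono mult_right_mono prod_nonneg) auto
      also have "\<dots> = (\<Prod>v\<in>U. \<mu> (a v)) * (\<Prod>e\<in>E. p\<^sup>2 / 256 * (16 * (r (a (h e)) * r (a (t e)))) * ?k e)"
        by (simp only: prod.distrib prod_constant mult_ac)
      also have "\<dots> \<le> (\<Prod>v\<in>U. \<mu> (a v)) * (\<Prod>e\<in>E. codegree X \<mu> M (a (h e)) (a (t e)))"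
      proof (intro mult_left_mono prod_mono prod_nonneg conjI)
        fix e assume e: "e \<in> E"
        show "0 \<le> p\<^sup>2 / 256 * (16 * (r (a (h e)) * r (a (t e)))) * ?k e"
          using K0[OF aE[OF e]] r0[OF hU(1)[OF e]] r0[OF hU(2)[OF e]] by simp
        show "p\<^sup>2 / 256 * (16 * (r (a (h e)) * r (a (t e)))) * ?k e \<le> codegree X \<mu> M (a (h e)) (a (t e))"
          using cod[OF aE[OF e]] by (simp add: mult_ac)
      qed (use pos AX aA in \<open>auto intro: less_imp_le\<close>)
      finally show "(p\<^sup>2 / 256) ^ card E * ((\<Prod>v\<in>U. \<alpha> (a v)) * (\<Prod>e\<in>E. ?k e))
          \<le> (\<Prod>v\<in>U. \<mu> (a v)) * (\<Prod>e\<in>E. codegree X \<mu> M (a (h e)) (a (t e)))" .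
    qed
    also have "\<dots> \<le> weighted_density U E h t X \<mu> (codegree X \<mu> M)"
      unfolding weighted_density_def
    proof (rule sum_mono2)
      show "finite (PiE U (\<lambda>_. X))" using fin graph by (intro finite_PiE) (auto simp: U_def)
      show "PiE U (\<lambda>_. A) \<subseteq> PiE U (\<lambda>_. X)" using A(1) by (rule PiE_mono)
      fix a assume a: "a \<in> PiE U (\<lambda>_. X) - PiE U (\<lambda>_. A)"
      have aX: "a v \<in> X" if "v \<in> U" for v using a that by auto
      show "0 \<le> (\<Prod>v\<in>U. \<mu> (a v)) * (\<Prod>e\<in>E. codegree X \<mu> M (a (h e)) (a (t e)))"
        using pos C0 hU aX by (intro mult_nonneg_nonneg prod_nonneg) (auto intro: less_imp_le)
    qed
    finally show ?thesis
      unfolding T_U p_def[symmetric] by (simp add: power_mult power_divide)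
  qed
qed


text \<open>Densities are multiplicative under tensor products. The product space is encoded in the
natural numbers again, which allows the square to be iterated.\<close>

lemma weighted_density_square:
  fixes \<mu> :: "nat \<Rightarrow> real" and K :: "nat \<Rightarrow> nat \<Rightarrow> real"
  assumes graph: "h ` E \<subseteq> V" "t ` E \<subseteq> V"
  defines "\<mu>' \<equiv> \<lambda>k. \<mu> (fst (prod_decode k)) * \<mu> (snd (prod_decode k))"
    and "K' \<equiv> \<lambda>k l. K (fst (prod_decode k)) (fst (prod_decode l)) * K (snd (prod_decode k)) (snd (prod_decode l))"
  shows "weighted_density V E h t (prod_encode ` (X \<times> X)) \<mu>' K' = (weighted_density V E h t X \<mu> K)\<^sup>2"
proof -
  let ?X2 = "prod_encode ` (X \<times> X)"
  let ?F = "\<lambda>a. (\<Prod>v\<in>V. \<mu> (a v)) * (\<Prod>e\<in>E. K (a (h e)) (a (t e)))"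
  let ?F' = "\<lambda>a. (\<Prod>v\<in>V. \<mu>' (a v)) * (\<Prod>e\<in>E. K' (a (h e)) (a (t e)))"
  let ?\<phi> = "\<lambda>(a, b). restrict (\<lambda>v. prod_encode (a v, b v)) V"
  let ?\<psi> = "\<lambda>c. (restrict (\<lambda>v. fst (prod_decode (c v))) V, restrict (\<lambda>v. snd (prod_decode (c v))) V)"
  have "weighted_density V E h t ?X2 \<mu>' K' = (\<Sum>(a, b)\<in>PiE V (\<lambda>_. X) \<times> PiE V (\<lambda>_. X). ?F a * ?F b)"
    unfolding weighted_density_def
  proof (rule sum.reindex_bij_witness[where i = ?\<phi> and j = ?\<psi>])
    fix c assume c: "c \<in> PiE V (\<lambda>_. ?X2)"
    show "?\<phi> (?\<psi> c) = c"
      using c by (auto simp: PiE_iff extensional_def fun_eq_iff)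
    show "?\<psi> c \<in> PiE V (\<lambda>_. X) \<times> PiE V (\<lambda>_. X)" using c by (force simp: PiE_iff)
    have e: "(\<Prod>e\<in>E. K' (c (h e)) (c (t e))) = (\<Prod>e\<in>E. K (fst (?\<psi> c) (h e)) (fst (?\<psi> c) (t e)) * K (snd (?\<psi> c) (h e)) (snd (?\<psi> c) (t e)))"
      using graph by (intro prod.cong refl) (auto simp: K'_def)
    show "(case ?\<psi> c of (a, b) \<Rightarrow> ?F a * ?F b) = ?F' c"
      unfolding e by (simp add: prod.distrib \<mu>'_def)
  next
    fix p assume p: "p \<in> PiE V (\<lambda>_. X) \<times> PiE V (\<lambda>_. X)"
    show "?\<psi> (?\<phi> p) = p"
      using p by (auto simp: PiE_iff extensional_def fun_eq_iff)
    show "?\<phi> p \<in> PiE V (\<lambda>_. ?X2)" using p by (auto simp: PiE_iff)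
  qed
  also have "\<dots> = (weighted_density V E h t X \<mu> K)\<^sup>2"
    unfolding weighted_density_def power2_eq_square sum_product by (simp add: sum.cartesian_product)
  finally show ?thesis .
qed

text \<open>Tensor power trick. Applied to the tensor power of order \<open>2 ^ k\<close>, the inequality up to a constant \<open>c\<close> says
that the ratio of the two sides, raised to the power \<open>2 ^ k\<close>, is at least \<open>c\<close>, for every \<open>k\<close>; this
forces the ratio to be at least \<open>1\<close>.\<close>

lemma finite_sidorenko:
  assumes KNRS: "finite_regular_KNRS V E h t"
    and graph: "finite V" "finite E" "h ` E \<subseteq> V" "t ` E \<subseteq> V"
    and X: "weighting (X :: nat set) \<mu>" and M: "symmetric_nonneg X M"
  shows "(\<Sum>x\<in>X. \<Sum>y\<in>X. \<mu> x * \<mu> y * M x y) ^ (2 * card E) \<le> weighted_density V E h t X \<mu> (codegree X \<mu> M)"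
proof -
  define c :: real where "c = (1/256) ^ card E"
  have c: "0 < c" by (simp add: c_def)
  define P where "P = (\<lambda>(X :: nat set) \<mu> M. (\<Sum>x\<in>X. \<Sum>y\<in>X. \<mu> x * \<mu> y * M x y :: real) ^ (2 * card E))"
  define T where "T = (\<lambda>(X :: nat set) \<mu> M. weighted_density V E h t X \<mu> (codegree X \<mu> M))"
  have power: "c * P X \<mu> M ^ (2 ^ k) \<le> T X \<mu> M ^ (2 ^ k)"
    if "weighting X \<mu>" "symmetric_nonneg X M" for X \<mu> M k
    using that
  proof (induction k arbitrary: X \<mu> M)
    case 0
    then show ?case using finite_sidorenko_up_to_constant[OF KNRS graph 0] by (simp add: c_def P_def T_def)
  next
    case (Suc k)
    define X' where "X' = prod_encode ` (X \<times> X)"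
    define \<mu>' where "\<mu>' = (\<lambda>k. \<mu> (fst (prod_decode k)) * \<mu> (snd (prod_decode k)))"
    define M' where "M' = (\<lambda>k l. M (fst (prod_decode k)) (fst (prod_decode l)) * M (snd (prod_decode k)) (snd (prod_decode l)))"
    have sum_X': "(\<Sum>k\<in>X'. f k) = (\<Sum>x\<in>X. \<Sum>y\<in>X. f (prod_encode (x, y)))" for f :: "nat \<Rightarrow> real"
      unfolding X'_def by (subst sum.reindex) (auto simp: inj_on_def sum.cartesian_product)
    have "weighting X' \<mu>'"
      using Suc.prems unfolding weighting_def sum_X'
      by (auto simp: X'_def \<mu>'_def sum_product[symmetric])
    moreover have "symmetric_nonneg X' M'"
      using Suc.prems by (auto simp: symmetric_nonneg_def X'_def M'_def)
    moreover have "P X' \<mu>' M' = (P X \<mu> M)\<^sup>2"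
    proof -
      have "(\<Sum>x\<in>X'. \<Sum>y\<in>X'. \<mu>' x * \<mu>' y * M' x y)
          = (\<Sum>x\<in>X. \<Sum>x'\<in>X. \<Sum>y\<in>X. \<Sum>y'\<in>X. (\<mu> x * \<mu> y * M x y) * (\<mu> x' * \<mu> y' * M x' y'))"
        unfolding sum_X' by (simp add: \<mu>'_def M'_def mult_ac)
      also have "\<dots> = (\<Sum>x\<in>X. \<Sum>y\<in>X. \<mu> x * \<mu> y * M x y)\<^sup>2"
        unfolding power2_eq_square sum_product ..
      finally show ?thesis unfolding P_def by (simp add: power_mult[symmetric] mult.commute)
    qed
    moreover have "T X' \<mu>' M' = (T X \<mu> M)\<^sup>2"
    proof -
      have "codegree X' \<mu>' M' = (\<lambda>k l. codegree X \<mu> M (fst (prod_decode k)) (fst (prod_decode l))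
          * codegree X \<mu> M (snd (prod_decode k)) (snd (prod_decode l)))"
        unfolding codegree_def sum_X' sum_product by (simp add: \<mu>'_def M'_def mult_ac)
      then show ?thesis
        unfolding T_def X'_def \<mu>'_def using weighted_density_square[OF graph(3,4)] by simp
    qed
    ultimately show ?case using Suc.IH[of X' \<mu>' M'] by (simp add: power_mult[symmetric])
  qed
  have P0: "0 \<le> P X \<mu> M" unfolding P_def by (simp add: power_mult)
  have T0: "0 \<le> T X \<mu> M" using order.trans[OF mult_nonneg_nonneg[OF less_imp_le[OF c] P0]] power[OF X M, of 0] by simp
  show ?thesis
  proof (rule ccontr)
    assume "\<not> ?thesis"
    then have less: "T X \<mu> M < P X \<mu> M" by (simp add: P_def T_def)
    define \<theta> where "\<theta> = T X \<mu> M / P X \<mu> M"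
    have \<theta>: "0 \<le> \<theta>" "\<theta> < 1" using less T0 by (auto simp: \<theta>_def)
    have "c \<le> \<theta> ^ (2 ^ k)" for k
      using power[OF X M, of k] less T0 by (simp add: \<theta>_def power_divide field_simps)
    moreover obtain n where "\<theta> ^ n < c" using real_arch_pow_inv[OF c \<theta>(2)] by blast
    moreover have "\<theta> ^ (2 ^ n) \<le> \<theta> ^ n" using \<theta> by (intro power_decreasing) auto
    ultimately show False by (meson not_le order.strict_trans1 order.trans)
  qed
qed


text \<open>The sum over the images of the subdivision vertices factorises over the edges of the original graph,
and the factor of an edge is the codegree of the images of its ends.\<close>

lemma weighted_density_subdivision:
  fixes V :: "'v set" and E :: "'e set" and \<mu> :: "'x \<Rightarrow> real"
  assumes fin: "finite V" "finite E" "finite X"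
    and ends: "\<And>e. e \<in> E \<Longrightarrow> F e = {h e, t e} \<and> h e \<noteq> t e \<and> h e \<in> V \<and> t e \<in> V"
  shows "weighted_density (Inl ` V \<union> Inr ` E) (SIGMA e:E. F e) (\<lambda>(e, v). Inr e) (\<lambda>(e, v). Inl v) X \<mu> M
       = weighted_density V E h t X \<mu> (codegree X \<mu> M)"
proof -
  let ?L = "\<lambda>a b. (\<Prod>v\<in>V. \<mu> (a v)) * (\<Prod>e\<in>E. \<mu> (b e) * (M (b e) (a (h e)) * M (b e) (a (t e))))"
  have "weighted_density (Inl ` V \<union> Inr ` E) (SIGMA e:E. F e) (\<lambda>(e, v). Inr e) (\<lambda>(e, v). Inl v) X \<mu> M
      = (\<Sum>(a, b)\<in>PiE V (\<lambda>_. X) \<times> PiE E (\<lambda>_. X). ?L a b)"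
    unfolding weighted_density_def
  proof (rule sum.reindex_bij_witness[where i = "\<lambda>(a, b). case_sum a b" and j = "\<lambda>c. (c \<circ> Inl, c \<circ> Inr)"])
    fix c :: "'v + 'e \<Rightarrow> 'x" assume c: "c \<in> PiE (Inl ` V \<union> Inr ` E) (\<lambda>_. X)"
    show "(case (c \<circ> Inl, c \<circ> Inr) of (a, b) \<Rightarrow> case_sum a b) = c"
      by (auto simp: fun_eq_iff split: sum.split)
    show "(c \<circ> Inl, c \<circ> Inr) \<in> PiE V (\<lambda>_. X) \<times> PiE E (\<lambda>_. X)"
      using c by (auto simp: PiE_iff extensional_def)
    have "(\<Prod>w\<in>Inl ` V \<union> Inr ` E. \<mu> (c w)) = (\<Prod>v\<in>V. \<mu> (c (Inl v))) * (\<Prod>e\<in>E. \<mu> (c (Inr e)))"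
      using fin by (subst prod.union_disjoint) (auto simp: prod.reindex)
    moreover have "(\<Prod>p\<in>(SIGMA e:E. F e). M (c (case p of (e, v) \<Rightarrow> Inr e)) (c (case p of (e, v) \<Rightarrow> Inl v)))
        = (\<Prod>e\<in>E. \<Prod>v\<in>F e. M (c (Inr e)) (c (Inl v)))"
      using fin ends by (subst prod.Sigma) (auto simp: case_prod_beta)
    moreover have "\<dots> = (\<Prod>e\<in>E. M (c (Inr e)) (c (Inl (h e))) * M (c (Inr e)) (c (Inl (t e))))"
      using ends by (intro prod.cong) auto
    ultimately show "(case (c \<circ> Inl, c \<circ> Inr) of (a, b) \<Rightarrow> ?L a b)
        = (\<Prod>w\<in>Inl ` V \<union> Inr ` E. \<mu> (c w)) *
          (\<Prod>p\<in>(SIGMA e:E. F e). M (c (case p of (e, v) \<Rightarrow> Inr e)) (c (case p of (e, v) \<Rightarrow> Inl v)))"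
      by (simp add: prod.distrib)
  next
    fix p :: "('v \<Rightarrow> 'x) \<times> ('e \<Rightarrow> 'x)"
    assume p: "p \<in> PiE V (\<lambda>_. X) \<times> PiE E (\<lambda>_. X)"
    show "((case p of (a, b) \<Rightarrow> case_sum a b) \<circ> Inl, (case p of (a, b) \<Rightarrow> case_sum a b) \<circ> Inr) = p"
      by (auto simp: fun_eq_iff split: prod.split)
    show "(case p of (a, b) \<Rightarrow> case_sum a b) \<in> PiE (Inl ` V \<union> Inr ` E) (\<lambda>_. X)"
      using p by (auto simp: PiE_iff extensional_def split: prod.split sum.split)
  qed
  also have "\<dots> = (\<Sum>a\<in>PiE V (\<lambda>_. X). \<Sum>b\<in>PiE E (\<lambda>_. X). ?L a b)"
    by (simp add: sum.cartesian_product)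
  also have "\<dots> = weighted_density V E h t X \<mu> (codegree X \<mu> M)"
    unfolding weighted_density_def codegree_def using fin
    by (simp add: sum_distrib_left[symmetric] prod_sum_PiE)
  finally show ?thesis .
qed

section \<open>Homomorphism densities of limits and of step kernels\<close>

lemma space_cube: "space (cube V) = PiE V (\<lambda>_. I01)"
  by (simp add: space_PiM)

text \<open>Equal to \<open>hom_density\<close> when \<open>h\<close> and \<open>t\<close> orient the edges of a graph (\<open>hom_density_oriented\<close>); the
orientation removes the choice of an order on the two ends that is hidden in \<open>edge_value\<close>.\<close>

definition density_on :: "'v set \<Rightarrow> 'e set \<Rightarrow> ('e \<Rightarrow> 'v) \<Rightarrow> ('e \<Rightarrow> 'v) \<Rightarrow> (real \<times> real \<Rightarrow> real) \<Rightarrow> real" where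
  "density_on V E h t K = (LINT x|cube V. (\<Prod>e\<in>E. K (x (h e), x (t e))))"

definition oriented :: "('v, 'e) mgraph \<Rightarrow> ('e \<Rightarrow> 'v) \<Rightarrow> ('e \<Rightarrow> 'v) \<Rightarrow> bool" where
  "oriented H h t \<longleftrightarrow> finite (verts H) \<and> finite (edges H) \<and>
    (\<forall>e\<in>edges H. ends H e = {h e, t e} \<and> h e \<noteq> t e \<and> h e \<in> verts H \<and> t e \<in> verts H)"

lemma loopless_orientable:
  assumes "loopless_multigraph H"
  obtains h t where "oriented H h t"
proof -
  have "\<forall>e\<in>edges H. \<exists>p. ends H e = {fst p, snd p} \<and> fst p \<noteq> snd p \<and> fst p \<in> verts H \<and> snd p \<in> verts H"
  proof
    fix e assume "e \<in> edges H"
    then obtain u v where "ends H e = {u, v}" "u \<noteq> v" "ends H e \<subseteq> verts H"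
      using assms unfolding loopless_multigraph_def card_2_iff by blast
    then show "\<exists>p. ends H e = {fst p, snd p} \<and> fst p \<noteq> snd p \<and> fst p \<in> verts H \<and> snd p \<in> verts H"
      by (intro exI[of _ "(u, v)"]) auto
  qed
  then obtain p where "\<forall>e\<in>edges H. ends H e = {fst (p e), snd (p e)} \<and> fst (p e) \<noteq> snd (p e)
      \<and> fst (p e) \<in> verts H \<and> snd (p e) \<in> verts H" by metis
  then show thesis
    using assms by (intro that[of "\<lambda>e. fst (p e)" "\<lambda>e. snd (p e)"]) (auto simp: oriented_def loopless_multigraph_def)
qed

lemma hom_density_oriented:
  assumes "oriented H h t" "\<And>x y. x \<in> I01 \<Longrightarrow> y \<in> I01 \<Longrightarrow> K (x, y) = K (y, x)"
  shows "hom_density H K = density_on (verts H) (edges H) h t K"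
  unfolding hom_density_def density_on_def
proof (intro Bochner_Integration.integral_cong refl prod.cong)
  fix x e assume x: "x \<in> space (cube (verts H))" and e: "e \<in> edges H"
  have "x (h e) \<in> I01" "x (t e) \<in> I01"
    using x e assms(1) unfolding space_cube oriented_def by auto
  then show "edge_value H K x e = K (x (h e), x (t e))"
    using assms e by (intro edge_value_eq) (auto simp: oriented_def)
qed

lemma finite_measure_cube: "finite V \<Longrightarrow> finite_measure (cube V)"
proof (rule finite_measureI)
  assume V: "finite V"
  interpret finite_measure "lebesgue_on I01" by (rule finite_measure_lebesgue_on_I01)
  interpret product_sigma_finite "\<lambda>_::'a. lebesgue_on I01" by standard
  have "emeasure (PiM V (\<lambda>_. lebesgue_on I01)) (PiE V (\<lambda>_. I01)) = (\<Prod>v\<in>V. emeasure (lebesgue_on I01) I01)"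
    by (rule emeasure_PiM[OF V]) (simp add: sets_restrict_space_iff)
  moreover have "PiE V (\<lambda>_. I01) \<in> sets (PiM V (\<lambda>_. lebesgue_on I01))"
    using V by (intro sets_PiM_I_finite) (auto simp: sets_restrict_space_iff)
  ultimately show "emeasure (cube V) (space (cube V)) \<noteq> \<infinity>"
    by (simp add: space_PiM emeasure_restrict_space)
qed

text \<open>Dominated convergence. Almost everywhere convergence on the square passes to each
edge of the graph by \<open>AE_cube_pair\<close>.\<close>

lemma density_on_tendsto:
  fixes U :: "nat \<Rightarrow> real \<times> real \<Rightarrow> real"
  assumes V: "finite V" "\<And>e. e \<in> E \<Longrightarrow> h e \<in> V \<and> t e \<in> V \<and> h e \<noteq> t e" and E: "finite E"
    and U: "\<And>n. U n \<in> borel_measurable (lebesgue_on (I01 \<times> I01))"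
    and W: "W \<in> borel_measurable (lebesgue_on (I01 \<times> I01))"
    and bound: "\<And>n p. p \<in> I01 \<times> I01 \<Longrightarrow> \<bar>U n p\<bar> \<le> 1"
    and lim: "AE p in lebesgue_on (I01 \<times> I01). (\<lambda>n. U n p) \<longlonglongrightarrow> W p"
  shows "(\<lambda>n. density_on V E h t (U n)) \<longlonglongrightarrow> density_on V E h t W"
  unfolding density_on_def
proof (rule integral_dominated_convergence[where w = "\<lambda>_. 1"])
  interpret finite_measure "cube V" by (rule finite_measure_cube[OF V(1)])
  show "integrable (cube V) (\<lambda>_. 1 :: real)" by simp
  show "(\<lambda>x. \<Prod>e\<in>E. W (x (h e), x (t e))) \<in> borel_measurable (cube V)"
    using V by (intro borel_measurable_prod cube_pair_measurable[OF W]) auto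
  show "(\<lambda>x. \<Prod>e\<in>E. U n (x (h e), x (t e))) \<in> borel_measurable (cube V)" for n
    using V by (intro borel_measurable_prod cube_pair_measurable[OF U]) auto
  have "AE x in cube V. \<forall>e\<in>E. (\<lambda>n. U n (x (h e), x (t e))) \<longlonglongrightarrow> W (x (h e), x (t e))"
    using V by (intro AE_finite_allI[OF E] AE_cube_pair[OF lim]) auto
  then show "AE x in cube V. (\<lambda>n. \<Prod>e\<in>E. U n (x (h e), x (t e))) \<longlonglongrightarrow> (\<Prod>e\<in>E. W (x (h e), x (t e)))"
    by eventually_elim (auto intro: tendsto_prod)
  show "AE x in cube V. norm (\<Prod>e\<in>E. U n (x (h e), x (t e))) \<le> 1" for n
  proof (rule AE_I2)
    fix x assume "x \<in> space (cube V)"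
    then have "(x (h e), x (t e)) \<in> I01 \<times> I01" if "e \<in> E" for e
      using V(2)[OF that] unfolding space_cube by auto
    then show "norm (\<Prod>e\<in>E. U n (x (h e), x (t e))) \<le> 1"
      unfolding prod_norm[symmetric] by (intro prod_le_1) (auto intro: bound)
  qed
qed

lemma square_integral_eq_pair_unif:
  fixes K :: "real \<times> real \<Rightarrow> real"
  assumes "K' \<in> borel_measurable borel" "AE p in lebesgue_on (I01 \<times> I01). K p = K' p"
    and "K \<in> borel_measurable (lebesgue_on (I01 \<times> I01))"
  shows "(LINT p:I01 \<times> I01|lebesgue. K p) = integral\<^sup>L (unif \<Otimes>\<^sub>M unif) K'"
proof -
  have "(LINT p:I01 \<times> I01|lebesgue. K p) = (LINT p|lebesgue_on (I01 \<times> I01). K p)"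
    unfolding set_lebesgue_integral_def by (subst integral_restrict_space) auto
  also have "\<dots> = (LINT p|lebesgue_on (I01 \<times> I01). K' p)"
    using assms measurable_compose[OF id_measurable_lebesgue_on assms(1)]
    by (intro integral_cong_AE) auto
  also have "\<dots> = integral\<^sup>L (unif \<Otimes>\<^sub>M unif) K'"
    unfolding pair_unif using assms(1) by (subst integral_distr[OF id_measurable_lebesgue_on]) auto
  finally show ?thesis .
qed

lemma cube_pair_integral:
  fixes K :: "real \<times> real \<Rightarrow> real"
  assumes K: "K \<in> borel_measurable (lebesgue_on (I01 \<times> I01))"
    and V: "finite V" "u \<in> V" "v \<in> V" "u \<noteq> v"
  shows "(LINT x|cube V. K (x u, x v)) = (LINT p:I01 \<times> I01|lebesgue. K p)"
proof -
  obtain K' where K': "K' \<in> borel_measurable borel" "AE p in lebesgue_on (I01 \<times> I01). K p = K' p"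
    using borel_representative[OF K] by blast
  have m: "(\<lambda>x. K' (x u, x v)) \<in> borel_measurable (PiM V (\<lambda>_. lebesgue_on I01))"
    by (rule measurable_compose[OF proj_measurable[OF V(2,3)] K'(1)])
  have "(LINT x|cube V. K (x u, x v)) = (LINT x|cube V. K' (x u, x v))"
    using cube_pair_measurable[OF K V] m AE_cube_pair[OF K'(2) V]
    by (intro integral_cong_AE) (auto intro: measurable_completion)
  also have "\<dots> = (LINT x|PiM V (\<lambda>_. lebesgue_on I01). K' (x u, x v))"
    by (rule integral_completion[OF m])
  also have "\<dots> = integral\<^sup>L (unif \<Otimes>\<^sub>M unif) K'"
    unfolding distr_PiM_pair[OF V, symmetric]
    by (rule integral_distr[OF proj_measurable[OF V(2,3)] K'(1), symmetric])
  also have "\<dots> = (LINT p:I01 \<times> I01|lebesgue. K p)"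
    by (rule square_integral_eq_pair_unif[OF K' K, symmetric])
  finally show ?thesis .
qed

lemma oriented_K2: "oriented K2 (\<lambda>_. 0) (\<lambda>_. 1)"
  by (simp add: oriented_def K2_def)

lemma hom_density_K2:
  assumes "kernel K"
  shows "hom_density K2 K = (LINT p:I01 \<times> I01|lebesgue. K p)"
proof -
  have "hom_density K2 K = density_on {0 :: nat, 1} {0 :: nat} (\<lambda>_. 0) (\<lambda>_. 1) K"
    using hom_density_oriented[OF oriented_K2, of K] assms by (simp add: kernel_def K2_def del: One_nat_def)
  also have "\<dots> = (LINT p:I01 \<times> I01|lebesgue. K p)"
    unfolding density_on_def using assms by (simp add: cube_pair_integral kernel_def del: One_nat_def)
  finally show ?thesis .
qed

text \<open>The partition of \<open>[0, 1]\<close> into the fibres of \<open>s\<close>, which realises a finite weighted space. Only the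
values of \<open>s\<close> on the unit interval are constrained.\<close>

definition cell_map :: "nat set \<Rightarrow> (nat \<Rightarrow> real) \<Rightarrow> (real \<Rightarrow> nat) \<Rightarrow> bool" where
  "cell_map X \<mu> s \<longleftrightarrow> s \<in> borel \<rightarrow>\<^sub>M count_space UNIV \<and> (\<forall>x\<in>I01. s x \<in> X) \<and>
     (\<forall>i\<in>X. measure lebesgue (I01 \<inter> s -` {i}) = \<mu> i)"

definition step_kernel :: "(real \<Rightarrow> nat) \<Rightarrow> (nat \<Rightarrow> nat \<Rightarrow> real) \<Rightarrow> real \<times> real \<Rightarrow> real" where
  "step_kernel s M p = M (s (fst p)) (s (snd p))"

lemma cell_sets: "s \<in> borel \<rightarrow>\<^sub>M count_space UNIV \<Longrightarrow> s -` {i} \<in> sets (borel :: real measure)"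
  for s :: "real \<Rightarrow> nat"
  using measurable_sets[of s borel "count_space UNIV" "{i}"] by simp

lemma step_kernel_borel_measurable:
  assumes "cell_map X \<mu> s"
  shows "step_kernel s M \<in> borel_measurable borel"
proof -
  have s: "s \<in> borel \<rightarrow>\<^sub>M count_space UNIV" using assms by (simp add: cell_map_def)
  have f: "(\<lambda>p :: real \<times> real. s (fst p)) \<in> borel \<rightarrow>\<^sub>M count_space UNIV"
    "(\<lambda>p :: real \<times> real. s (snd p)) \<in> borel \<rightarrow>\<^sub>M count_space UNIV"
    by (rule measurable_compose[OF borel_measurable_continuous_onI[OF continuous_on_fst[OF continuous_on_id]] s],
        rule measurable_compose[OF borel_measurable_continuous_onI[OF continuous_on_snd[OF continuous_on_id]] s])
  have "(\<lambda>p :: real \<times> real. M i (s (snd p))) \<in> borel_measurable borel" for i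
    by (rule measurable_compose[OF f(2)]) simp
  from measurable_compose_countable[OF this f(1)] show ?thesis
    by (simp add: step_kernel_def[abs_def])
qed

lemma step_kernel_measurable:
  "cell_map X \<mu> s \<Longrightarrow> step_kernel s M \<in> borel_measurable (lebesgue_on (I01 \<times> I01))"
  by (rule measurable_compose[OF id_measurable_lebesgue_on step_kernel_borel_measurable])

text \<open>On the box of points with coordinates in prescribed cells the integrand is constant, and the
measure of the box is the product of the weights.\<close>

lemma density_on_step_kernel:
  assumes V: "finite V" "h ` E \<subseteq> V" "t ` E \<subseteq> V" and X: "finite X" and s: "cell_map X \<mu> s"
  shows "density_on V E h t (step_kernel s M) = weighted_density V E h t X \<mu> M"
proof -
  interpret finite_measure "lebesgue_on I01" by (rule finite_measure_lebesgue_on_I01)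
  interpret product_sigma_finite "\<lambda>_::'a. lebesgue_on I01" by standard
  interpret C: finite_measure "cube V" by (rule finite_measure_cube[OF V(1)])
  let ?c = "\<lambda>a. \<Prod>e\<in>E. M (a (h e)) (a (t e))"
  let ?B = "\<lambda>a. PiE V (\<lambda>v. I01 \<inter> s -` {a v})"
  have cell: "I01 \<inter> s -` {i} \<in> sets (lebesgue_on I01)" for i
    using cell_sets[of s i] s by (auto simp: sets_restrict_space_iff cell_map_def)
  have B: "?B a \<in> sets (PiM V (\<lambda>_. lebesgue_on I01))" for a
    using V cell by (intro sets_PiM_I_finite) auto
  have mB: "measure (cube V) (?B a) = (\<Prod>v\<in>V. \<mu> (a v))" if "a \<in> PiE V (\<lambda>_. X)" for a
  proof -
    have "emeasure (cube V) (?B a) = (\<Prod>v\<in>V. emeasure (lebesgue_on I01) (I01 \<inter> s -` {a v}))"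
      using B V cell by (simp add: emeasure_PiM)
    also have "\<dots> = (\<Prod>v\<in>V. ennreal (measure (lebesgue_on I01) (I01 \<inter> s -` {a v})))"
      by (simp add: emeasure_eq_measure)
    also have "\<dots> = ennreal (\<Prod>v\<in>V. measure (lebesgue_on I01) (I01 \<inter> s -` {a v}))"
      by (simp add: prod_ennreal)
    finally have "measure (cube V) (?B a) = (\<Prod>v\<in>V. measure (lebesgue_on I01) (I01 \<inter> s -` {a v}))"
      unfolding measure_def[of "cube V"] by (simp add: prod_nonneg)
    also have "\<dots> = (\<Prod>v\<in>V. \<mu> (a v))"
      using s that by (intro prod.cong refl) (auto simp: measure_restrict_space cell_map_def PiE_iff)
    finally show ?thesis .
  qed
  have "density_on V E h t (step_kernel s M)
      = (LINT x|cube V. (\<Sum>a\<in>PiE V (\<lambda>_. X). ?c a * indicator (?B a) x))"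
    unfolding density_on_def
  proof (rule Bochner_Integration.integral_cong[OF refl])
    fix x assume "x \<in> space (cube V)"
    then have x: "x \<in> PiE V (\<lambda>_. I01)" unfolding space_cube .
    let ?a = "restrict (\<lambda>v. s (x v)) V"
    have a: "?a \<in> PiE V (\<lambda>_. X)" using x s by (auto simp: cell_map_def)
    have "indicator (?B a) x = (if a = ?a then 1 else 0 :: real)" if "a \<in> PiE V (\<lambda>_. X)" for a
    proof -
      have "x \<in> ?B a \<longleftrightarrow> (\<forall>v\<in>V. s (x v) = a v)" using x by (auto simp: PiE_iff)
      also have "\<dots> \<longleftrightarrow> a = ?a" using that by (auto simp: fun_eq_iff PiE_iff extensional_def)
      finally show ?thesis by (simp add: indicator_def)
    qed
    then have "(\<Sum>a\<in>PiE V (\<lambda>_. X). ?c a * indicator (?B a) x)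
        = (\<Sum>a\<in>PiE V (\<lambda>_. X). if a = ?a then ?c a else 0)"
      by (intro sum.cong) auto
    also have "\<dots> = ?c ?a"
      using a V X by (simp add: sum.delta finite_PiE)
    also have "\<dots> = (\<Prod>e\<in>E. step_kernel s M (x (h e), x (t e)))"
      using V by (intro prod.cong) (auto simp: step_kernel_def image_subset_iff)
    finally show "(\<Prod>e\<in>E. step_kernel s M (x (h e), x (t e)))
        = (\<Sum>a\<in>PiE V (\<lambda>_. X). ?c a * indicator (?B a) x)" ..
  qed
  also have "\<dots> = (\<Sum>a\<in>PiE V (\<lambda>_. X). ?c a * measure (cube V) (?B a))"
  proof (subst Bochner_Integration.integral_sum)
    have B': "?B a \<in> sets (cube V)" for a using B by (rule sets_completionI_sets)
    show "integrable (cube V) (\<lambda>x. ?c a * indicator (?B a) x)" for a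
      using B' C.emeasure_finite[of "?B a"]
      by (intro integrable_mult_right integrable_real_indicator) (simp_all add: less_top)
    show "(\<Sum>a\<in>PiE V (\<lambda>_. X). LINT x|cube V. ?c a * indicator (?B a) x)
        = (\<Sum>a\<in>PiE V (\<lambda>_. X). ?c a * measure (cube V) (?B a))"
    proof (intro sum.cong refl)
      fix a assume "a \<in> PiE V (\<lambda>_. X)"
      have "?B a \<inter> space (PiM V (\<lambda>_. lebesgue_on I01)) = ?B a"
        using sets.sets_into_space[OF B[of a]] by blast
      then show "(LINT x|cube V. ?c a * indicator (?B a) x) = ?c a * measure (cube V) (?B a)" by simp
    qed
  qed
  also have "\<dots> = weighted_density V E h t X \<mu> M"
    unfolding weighted_density_def by (intro sum.cong refl) (simp add: mB mult.commute)
  finally show ?thesis .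
qed

section \<open>From graphons to finite probability spaces\<close>

text \<open>Consecutive intervals of the prescribed lengths; each induction step appends one interval on the right.\<close>

lemma cell_map_exists:
  assumes "weighting X \<mu>"
  obtains s where "cell_map X \<mu> s"
proof -
  have "finite X" "X \<noteq> {}" using assms by (auto simp: weighting_def)
  then have "(\<forall>x\<in>X. 0 \<le> \<mu> x) \<Longrightarrow> \<exists>s. s \<in> borel \<rightarrow>\<^sub>M count_space UNIV \<and> (\<forall>x. s x \<in> X) \<and>
     (\<forall>i\<in>X. measure lebesgue ({0..sum \<mu> X} \<inter> s -` {i}) = \<mu> i)"
  proof (induction X rule: finite_ne_induct)
    case (singleton i)
    then show ?case by (intro exI[of _ "\<lambda>_. i"]) auto
  next
    case (insert j X)
    then obtain s where s: "s \<in> borel \<rightarrow>\<^sub>M count_space UNIV" "\<And>x. s x \<in> X"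
      "\<And>i. i \<in> X \<Longrightarrow> measure lebesgue ({0..sum \<mu> X} \<inter> s -` {i}) = \<mu> i" by auto
    have S0: "0 \<le> sum \<mu> X" and j: "0 \<le> \<mu> j" using insert.prems by (auto intro: sum_nonneg)
    let ?s = "\<lambda>x. if x \<le> sum \<mu> X then s x else j"
    have "?s \<in> borel \<rightarrow>\<^sub>M count_space UNIV" using s(1) by measurable
    moreover have "measure lebesgue ({0..sum \<mu> (insert j X)} \<inter> ?s -` {i}) = \<mu> i" if "i \<in> insert j X" for i
    proof (cases "i = j")
      case True
      then have "{0..sum \<mu> (insert j X)} \<inter> ?s -` {i} = {sum \<mu> X<..sum \<mu> X + \<mu> j}"
        using insert.hyps s(2) S0 by (auto simp: add.commute not_le[symmetric])
      then show ?thesis using True j by simp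
    next
      case False
      then have "{0..sum \<mu> (insert j X)} \<inter> ?s -` {i} = {0..sum \<mu> X} \<inter> s -` {i}"
        using insert.hyps j by (auto split: if_splits)
      then show ?thesis using False that s(3) by simp
    qed
    ultimately show ?case using s(2) by (intro exI[of _ ?s]) auto
  qed
  then obtain s where "s \<in> borel \<rightarrow>\<^sub>M count_space UNIV" "\<And>x. s x \<in> X"
    "\<And>i. i \<in> X \<Longrightarrow> measure lebesgue ({0..sum \<mu> X} \<inter> s -` {i}) = \<mu> i"
    using assms by (auto simp: weighting_def less_imp_le)
  then have "cell_map X \<mu> s" using assms by (simp add: weighting_def cell_map_def)
  then show thesis by (rule that)
qed

lemma null_sets_cross:
  fixes N :: "real set"
  assumes "N \<in> null_sets lborel"
  shows "N \<times> UNIV \<union> UNIV \<times> N \<in> null_sets (lborel :: (real \<times> real) measure)"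
proof (rule null_sets.Un)
  have N: "N \<in> sets borel" using assms by auto
  have "emeasure lborel (N \<times> (UNIV :: real set)) = 0" "emeasure lborel ((UNIV :: real set) \<times> N) = 0"
    unfolding lborel_prod[symmetric] using assms N
    by (simp_all add: lborel.emeasure_pair_measure_Times null_setsD1)
  moreover have "N \<times> (UNIV :: real set) \<in> sets borel" "(UNIV :: real set) \<times> N \<in> sets borel"
    using N by (auto intro!: borel_Times)
  ultimately show "N \<times> UNIV \<in> null_sets (lborel :: (real \<times> real) measure)"
    "UNIV \<times> N \<in> null_sets (lborel :: (real \<times> real) measure)" by auto
qed

text \<open>Local density quantifies over Lebesgue measurable sets, whereas products are computed for Borel
sets. The two squares differ by a subset of a null cross.\<close>

lemma lebesgue_square_borel:
  assumes "S \<in> sets lebesgue" "S \<subseteq> I01"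
  obtains B where "B \<in> sets borel" "B \<subseteq> I01" "measure lebesgue S = measure lebesgue B"
    "\<And>F :: real \<times> real \<Rightarrow> real. F \<in> borel_measurable (lebesgue_on (I01 \<times> I01)) \<Longrightarrow>
       (LINT p:S \<times> S|lebesgue. F p) = (LINT p:B \<times> B|lebesgue. F p)"
proof -
  obtain B N N' where SB: "S = B \<union> N" and N: "N \<subseteq> N'" "N' \<in> null_sets lborel" and B: "B \<in> sets lborel"
    using assms(1) by (rule sets_completionE)
  have BI: "B \<subseteq> I01" using SB assms by auto
  have "N \<in> null_sets lebesgue" using N by (meson null_sets_completion_subset null_sets_completionI)
  then have "measure lebesgue S = measure lebesgue B"
    unfolding SB using B by (intro measure_Un_null_set) auto
  moreover have "(LINT p:S \<times> S|lebesgue. F p) = (LINT p:B \<times> B|lebesgue. F p)"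
    if F: "F \<in> borel_measurable (lebesgue_on (I01 \<times> I01))" for F :: "real \<times> real \<Rightarrow> real"
  proof -
    have "N' \<times> UNIV \<union> UNIV \<times> N' \<in> null_sets lborel" using N(2) by (rule null_sets_cross)
    then have ae: "AE p in lborel. p \<notin> N' \<times> UNIV \<union> UNIV \<times> N'"
      by (rule AE_not_in)
    have BB: "B \<times> B \<in> sets borel" using B by (auto intro!: borel_Times)
    have F0: "(\<lambda>p. if p \<in> I01 \<times> I01 then F p else 0) \<in> borel_measurable lebesgue"
      using F by (subst borel_measurable_if) auto
    have "(\<lambda>p. indicator (B \<times> B) p * (if p \<in> I01 \<times> I01 then F p else 0)) \<in> borel_measurable lebesgue"
      using BB F0 by (intro borel_measurable_times borel_measurable_indicator) auto
    then have 1: "(\<lambda>p. indicator (B \<times> B) p *\<^sub>R F p) \<in> borel_measurable lebesgue"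
      by (rule back_subst[of "\<lambda>f. f \<in> borel_measurable lebesgue"]) (use BI in \<open>auto simp: fun_eq_iff indicator_def\<close>)
    have 2: "AE p in lebesgue. indicator (B \<times> B) p *\<^sub>R F p = indicator (S \<times> S) p *\<^sub>R F p"
      using AE_completion[OF ae] by eventually_elim (use SB N in \<open>auto simp: indicator_def\<close>)
    show ?thesis unfolding set_lebesgue_integral_def
      using 1 2 borel_measurable_completion_AE_cong[OF 1 2] by (intro integral_cong_AE) auto
  qed
  ultimately show thesis using B BI by (intro that) auto
qed

lemma measure_lebesgue_Times_borel:
  fixes C D :: "real set"
  assumes "C \<in> sets borel" "D \<in> sets borel"
  shows "measure lebesgue (C \<times> D) = measure lebesgue C * measure lebesgue D"
proof -
  have "C \<times> D \<in> sets borel" using assms by (intro borel_Times)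
  then show ?thesis
    using assms by (simp add: measure_def lborel_prod[symmetric] lborel.emeasure_pair_measure_Times enn2real_mult)
qed

lemma step_kernel_integral:
  assumes X: "finite X" and s: "cell_map X \<mu> s" and B: "B \<in> sets borel" "B \<subseteq> I01"
  shows "(LINT p:B \<times> B|lebesgue. step_kernel s M p)
    = (\<Sum>i\<in>X. \<Sum>j\<in>X. measure lebesgue (B \<inter> s -` {i}) * measure lebesgue (B \<inter> s -` {j}) * M i j)"
proof -
  let ?C = "\<lambda>i. B \<inter> s -` {i}"
  have sX: "s x \<in> X" if "x \<in> B" for x using s B(2) that by (auto simp: cell_map_def)
  have C: "?C i \<in> sets borel" for i using B(1) cell_sets[of s i] s by (auto simp: cell_map_def)
  have CC: "?C i \<times> ?C j \<in> sets lebesgue" for i j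
    using borel_Times[OF C C, of i j] by auto
  have fin: "emeasure lebesgue (?C i \<times> ?C j) < \<infinity>" for i j
  proof -
    have "emeasure lebesgue (?C i \<times> ?C j) \<le> emeasure lebesgue (I01 \<times> I01)"
      by (rule emeasure_mono) (use B(2) in auto)
    also have "\<dots> = 1" using square_sets(1)
      by (simp add: lborel_prod[symmetric] lborel.emeasure_pair_measure_Times)
    finally show ?thesis by (rule le_less_trans) simp
  qed
  have "(LINT p:B \<times> B|lebesgue. step_kernel s M p)
      = (LINT p|lebesgue. (\<Sum>i\<in>X. \<Sum>j\<in>X. M i j * indicator (?C i \<times> ?C j) p))"
    unfolding set_lebesgue_integral_def
  proof (intro Bochner_Integration.integral_cong refl)
    fix p :: "real \<times> real"
    have e: "(indicator (?C i \<times> ?C j) p :: real)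
        = (if s (fst p) = i then 1 else 0) * (if s (snd p) = j then 1 else 0) * indicator (B \<times> B) p" for i j
      by (auto simp: indicator_def mem_Times_iff)
    show "indicator (B \<times> B) p *\<^sub>R step_kernel s M p = (\<Sum>i\<in>X. \<Sum>j\<in>X. M i j * indicator (?C i \<times> ?C j) p)"
    proof (cases "p \<in> B \<times> B")
      case True
      then have "s (fst p) \<in> X" "s (snd p) \<in> X" using sX by auto
      have "(\<Sum>i\<in>X. \<Sum>j\<in>X. M i j * indicator (?C i \<times> ?C j) p)
          = (\<Sum>i\<in>X. \<Sum>j\<in>X. if s (snd p) = j then if s (fst p) = i then M i j else 0 else 0)"
        unfolding e using True by (intro sum.cong refl) auto
      also have "\<dots> = (\<Sum>i\<in>X. if s (fst p) = i then M i (s (snd p)) else 0)"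
        using X \<open>s (snd p) \<in> X\<close> by (intro sum.cong refl) (simp add: sum.delta')
      also have "\<dots> = M (s (fst p)) (s (snd p))"
        using X \<open>s (fst p) \<in> X\<close> by (simp add: sum.delta')
      finally show ?thesis using True by (simp add: step_kernel_def)
    next
      case False
      then show ?thesis unfolding e by simp
    qed
  qed
  also have "\<dots> = (\<Sum>i\<in>X. \<Sum>j\<in>X. M i j * measure lebesgue (?C i \<times> ?C j))"
    using CC fin by (simp add: Bochner_Integration.integral_sum)
  finally show ?thesis
    by (simp add: measure_lebesgue_Times_borel[OF C C] mult_ac)
qed

text \<open>Divided by an upper bound \<open>c\<close> of its entries, the matrix becomes a step graphon that is \<open>1 / c\<close>-locally dense
and \<open>1 / c\<close>-regular; the powers of \<open>c\<close> on the two sides of the resulting inequality cancel.\<close>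

lemma regular_KNRS_imp_finite:
  assumes R: "regular_KNRS G" and G: "oriented G h t"
  shows "finite_regular_KNRS (verts G) (edges G) h t"
  unfolding finite_regular_KNRS_def
proof (intro allI impI)
  fix A :: "nat set" and \<alpha> K
  assume A: "weighting A \<alpha>" and K: "symmetric_nonneg A K"
    and row: "\<forall>x\<in>A. (\<Sum>y\<in>A. K x y * \<alpha> y) = 1"
    and dense: "\<forall>b. (\<Sum>x\<in>A. b x)\<^sup>2 \<le> (\<Sum>x\<in>A. \<Sum>y\<in>A. b x * b y * K x y)"
  have fin: "finite A" using A by (simp add: weighting_def)
  obtain s where s: "cell_map A \<alpha> s" using cell_map_exists[OF A] by blast
  have sA: "s x \<in> A" if "x \<in> I01" for x using s that by (simp add: cell_map_def)
  define c where "c = 1 + (\<Sum>x\<in>A. \<Sum>y\<in>A. K x y)"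
  have K0: "0 \<le> K x y" if "x \<in> A" "y \<in> A" for x y using K that by (auto simp: symmetric_nonneg_def)
  have c1: "1 \<le> c" unfolding c_def using K0 by (simp add: sum_nonneg)
  have Kc: "K x y \<le> c" if "x \<in> A" "y \<in> A" for x y
  proof -
    have "K x y \<le> (\<Sum>y\<in>A. K x y)" using that fin K0 by (intro member_le_sum) auto
    also have "\<dots> \<le> (\<Sum>x\<in>A. \<Sum>y\<in>A. K x y)"
      using that fin K0 by (intro member_le_sum[of x A "\<lambda>x. \<Sum>y\<in>A. K x y"]) (auto intro: sum_nonneg)
    finally show ?thesis by (simp add: c_def)
  qed
  define W where "W = step_kernel s (\<lambda>i j. K i j / c)"
  have W: "graphon W"
    unfolding graphon_def
  proof (intro conjI ballI)
    show "W \<in> borel_measurable (lebesgue_on (I01 \<times> I01))" unfolding W_def by (rule step_kernel_measurable[OF s])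
    show "W ` (I01 \<times> I01) \<subseteq> {0..1}"
      using sA K0 Kc c1 by (auto simp: W_def step_kernel_def)
    show "W (x, y) = W (y, x)" if "x \<in> I01" "y \<in> I01" for x y
      using sA that K by (simp add: W_def step_kernel_def symmetric_nonneg_def)
  qed
  have "locally_dense (1 / c) W"
    unfolding locally_dense_def
  proof (intro allI impI)
    fix S :: "real set" assume S: "S \<in> sets lebesgue \<and> S \<subseteq> I01"
    then obtain B where B: "B \<in> sets borel" "B \<subseteq> I01" "measure lebesgue S = measure lebesgue B"
      "(LINT p:S \<times> S|lebesgue. W p) = (LINT p:B \<times> B|lebesgue. W p)"
      using lebesgue_square_borel[of S] W unfolding graphon_def by metis
    let ?b = "\<lambda>i. measure lebesgue (B \<inter> s -` {i})"
    have C: "B \<inter> s -` {i} \<in> sets borel" for i using B(1) cell_sets[of s i] s by (auto simp: cell_map_def)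
    have "measure lebesgue (\<Union>i\<in>A. B \<inter> s -` {i}) = (\<Sum>i\<in>A. ?b i)"
    proof (rule measure_finite_Union[OF fin])
      show "emeasure lebesgue (B \<inter> s -` {i}) \<noteq> \<infinity>" for i
      proof -
        have "emeasure lebesgue (B \<inter> s -` {i}) \<le> emeasure lebesgue I01"
          by (rule emeasure_mono) (use B(2) in auto)
        then show ?thesis by (auto simp: top_unique)
      qed
    qed (use C in \<open>auto simp: disjoint_family_on_def\<close>)
    moreover have "(\<Union>i\<in>A. B \<inter> s -` {i}) = B" using sA B(2) by auto
    ultimately have "1 / c * (measure lebesgue S)\<^sup>2 = (\<Sum>i\<in>A. ?b i)\<^sup>2 / c" by (simp add: B(3))
    also have "\<dots> \<le> (\<Sum>i\<in>A. \<Sum>j\<in>A. ?b i * ?b j * K i j) / c"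
      using dense[rule_format, of ?b] c1 by (intro divide_right_mono) auto
    also have "\<dots> = (LINT p:B \<times> B|lebesgue. W p)"
      unfolding W_def step_kernel_integral[OF fin s B(1,2)] by (simp add: sum_divide_distrib)
    finally show "1 / c * (measure lebesgue S)\<^sup>2 \<le> (LINT p:S \<times> S|lebesgue. W p)" by (simp add: B(4))
  qed
  moreover have "regular_graphon (1 / c) W"
    unfolding regular_graphon_def
  proof (rule AE_I2)
    fix x assume "x \<in> space (lebesgue_on I01)"
    then have x: "x \<in> I01" by simp
    have C: "I01 \<inter> s -` {i} \<in> sets lebesgue" for i using cell_sets[of s i] s by (auto simp: cell_map_def)
    have fC: "emeasure lebesgue (I01 \<inter> s -` {i}) < \<infinity>" for i
      using emeasure_mono[of "I01 \<inter> s -` {i}" I01 lebesgue] by (auto simp: less_top[symmetric] top_unique)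
    have "(LINT y:I01|lebesgue. W (x, y)) = (LINT y|lebesgue. (\<Sum>j\<in>A. K (s x) j / c * indicator (I01 \<inter> s -` {j}) y))"
      unfolding set_lebesgue_integral_def
    proof (intro Bochner_Integration.integral_cong refl)
      fix y :: real
      show "indicator I01 y *\<^sub>R W (x, y) = (\<Sum>j\<in>A. K (s x) j / c * indicator (I01 \<inter> s -` {j}) y)"
      proof (cases "y \<in> I01")
        case True
        then have "(\<Sum>j\<in>A. K (s x) j / c * indicator (I01 \<inter> s -` {j}) y) = (\<Sum>j\<in>A. if s y = j then K (s x) j / c else 0)"
          by (intro sum.cong refl) (auto simp: indicator_def)
        then show ?thesis using True fin sA[OF True] by (simp add: sum.delta' W_def step_kernel_def)
      next
        case False
        then have "indicator (I01 \<inter> s -` {j}) y = (0 :: real)" for j using False by (auto simp: indicator_def)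
        then show ?thesis using False by simp
      qed
    qed
    also have "\<dots> = (\<Sum>j\<in>A. K (s x) j / c * measure lebesgue (I01 \<inter> s -` {j}))"
      using C fC by (simp add: Bochner_Integration.integral_sum)
    also have "\<dots> = (\<Sum>j\<in>A. K (s x) j * \<alpha> j) / c"
      unfolding sum_divide_distrib using s by (intro sum.cong refl) (simp add: cell_map_def)
    also have "\<dots> = 1 / c" using row sA[OF x] by simp
    finally show "(LINT y:I01|lebesgue. W (x, y)) = 1 / c" .
  qed
  ultimately have "(1 / c) ^ card (edges G) \<le> hom_density G W"
    using R W c1 unfolding regular_KNRS_def by auto
  also have "\<dots> = density_on (verts G) (edges G) h t W"
    using W by (intro hom_density_oriented[OF G]) (simp add: graphon_def)
  also have "\<dots> = weighted_density (verts G) (edges G) h t A \<alpha> (\<lambda>i j. K i j / c)"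
    unfolding W_def using G by (intro density_on_step_kernel[OF _ _ _ fin s]) (auto simp: oriented_def)
  also have "\<dots> = weighted_density (verts G) (edges G) h t A \<alpha> K * (1 / c) ^ card (edges G)"
    unfolding weighted_density_def by (simp add: prod_dividef sum_divide_distrib power_one_over field_simps)
  finally show "1 \<le> weighted_density (verts G) (edges G) h t A \<alpha> K"
    using c1 by (simp add: power_one_over divide_le_cancel zero_less_power[of c "card (edges G)"])
qed

section \<open>From finite probability spaces to graphons\<close>

text \<open>The index of the interval \<open>(i / n, (i + 1) / n]\<close> that contains \<open>x\<close>; truncation in \<open>nat\<close> puts \<open>0\<close> into the first
interval. Closing the intervals on the right keeps the index of \<open>1\<close> below \<open>n\<close>.\<close>

definition uniform_cell :: "nat \<Rightarrow> real \<Rightarrow> nat" where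
  "uniform_cell n x = nat (\<lceil>real n * x\<rceil> - 1)"

lemma uniform_cell_close:
  assumes "0 < n" "x \<in> I01"
  shows "uniform_cell n x < n" "\<bar>real (uniform_cell n x) / real n - x\<bar> \<le> 1 / real n"
proof -
  have n: "0 < real n" using assms by simp
  have nx: "0 \<le> real n * x" "real n * x \<le> real n" using assms by (auto simp: mult_le_cancel_left1)
  have "real (uniform_cell n x) \<le> real n * x" "real n * x \<le> real (uniform_cell n x) + 1"
    "uniform_cell n x < n"
    using nx assms(1) unfolding uniform_cell_def by linarith+
  then have "uniform_cell n x < n" "\<bar>real (uniform_cell n x) - real n * x\<bar> \<le> 1" by auto
  moreover have "\<bar>real (uniform_cell n x) / real n - x\<bar> = \<bar>real (uniform_cell n x) - real n * x\<bar> / real n"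
  proof -
    have "real (uniform_cell n x) / real n - x = (real (uniform_cell n x) - real n * x) / real n"
      using n by (simp add: field_simps)
    then show ?thesis using n by simp
  qed
  ultimately show "uniform_cell n x < n" "\<bar>real (uniform_cell n x) / real n - x\<bar> \<le> 1 / real n"
    using n by (auto intro: divide_right_mono)
qed

lemma cell_map_uniform:
  assumes "0 < n"
  shows "cell_map {..<n} (\<lambda>_. 1 / real n) (uniform_cell n)"
  unfolding cell_map_def
proof (intro conjI ballI)
  show "uniform_cell n \<in> borel \<rightarrow>\<^sub>M count_space UNIV"
    unfolding uniform_cell_def by measurable
  show "uniform_cell n x \<in> {..<n}" if "x \<in> I01" for x using uniform_cell_close[OF assms that] by simp
  fix i assume "i \<in> {..<n}"
  then have i: "i < n" by simp
  let ?J = "{real i / real n<..real (Suc i) / real n}"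
  have J: "?J \<subseteq> I01 \<inter> uniform_cell n -` {i}"
  proof
    fix x assume "x \<in> ?J"
    then have x: "real i < real n * x" "real n * x \<le> real i + 1" using assms by (auto simp: field_simps)
    moreover have "real i + 1 \<le> real n" using i by linarith
    ultimately have "0 \<le> real n * x" "real n * x \<le> real n" by linarith+
    then have "real n * 0 \<le> real n * x" "real n * x \<le> real n * 1" "0 < real n"
      unfolding mult_zero_right mult_1_right using assms by auto
    then have "0 \<le> x" "x \<le> 1" by (simp_all only: mult_le_cancel_left_pos)
    then have "x \<in> I01" by simp
    moreover have "uniform_cell n x = i" using x unfolding uniform_cell_def by linarith
    ultimately show "x \<in> I01 \<inter> uniform_cell n -` {i}" by simp
  qed
  have J': "I01 \<inter> uniform_cell n -` {i} \<subseteq> insert 0 ?J"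
  proof
    fix x assume x: "x \<in> I01 \<inter> uniform_cell n -` {i}"
    show "x \<in> insert 0 ?J"
    proof (cases "x = 0")
      case False
      then have "0 < real n * x" using x assms by auto
      then have "real i < real n * x" "real n * x \<le> real i + 1"
        using x unfolding uniform_cell_def by auto linarith+
      then show ?thesis using assms by (auto simp: field_simps)
    qed simp
  qed
  have m: "measure lebesgue ?J = 1 / real n" using assms by (simp add: field_simps)
  have "I01 \<inter> uniform_cell n -` {i} = ?J \<or> I01 \<inter> uniform_cell n -` {i} = insert 0 ?J"
    using J J' by auto
  moreover have "measure lebesgue (insert 0 ?J) = measure lebesgue ?J"
    using measure_Un_null_set[of ?J lebesgue "{0}"] by (simp add: null_sets_completionI)
  ultimately show "measure lebesgue (I01 \<inter> uniform_cell n -` {i}) = 1 / real n" using m by auto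
qed

text \<open>Both densities are continuous along bounded almost everywhere limits, so the inequality
passes to the limit.\<close>

lemma sidorenko_by_approximation:
  assumes H: "loopless_multigraph H" and U: "\<And>n. graphon (U n)" and W: "graphon W"
    and lim: "AE p in lebesgue_on (I01 \<times> I01). (\<lambda>n. U n p) \<longlonglongrightarrow> W p"
    and le: "\<And>n. hom_density K2 (U n) ^ k \<le> hom_density H (U n)"
  shows "hom_density K2 W ^ k \<le> hom_density H W"
proof -
  have *: "(\<lambda>n. hom_density F (U n)) \<longlonglongrightarrow> hom_density F W"
    if F: "oriented F h t" for F :: "('x, 'y) mgraph" and h t
  proof -
    have "hom_density F K = density_on (verts F) (edges F) h t K" if "graphon K" for K
      using that by (intro hom_density_oriented[OF F]) (simp add: graphon_def)
    moreover have "(\<lambda>n. density_on (verts F) (edges F) h t (U n)) \<longlonglongrightarrow> density_on (verts F) (edges F) h t W"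
    proof (rule density_on_tendsto[OF _ _ _ _ _ _ lim])
      show "\<bar>U n p\<bar> \<le> 1" if "p \<in> I01 \<times> I01" for n p
        using U[of n] that unfolding graphon_def by (fastforce simp: image_subset_iff)
    qed (use F U W in \<open>auto simp: oriented_def graphon_def\<close>)
    ultimately show ?thesis using U W by simp
  qed
  obtain h t where "oriented H h t" using loopless_orientable[OF H] .
  from *[OF this] tendsto_power[OF *[OF oriented_K2], of k] le show ?thesis
    by (intro LIMSEQ_le) auto
qed

lemma oriented_Sub:
  assumes "oriented G h t"
  shows "oriented (Sub G) (\<lambda>(e, v). Inr e) (\<lambda>(e, v). Inl v)" "card (edges (Sub G)) = 2 * card (edges G)"
proof -
  have fin: "finite (ends G e)" "card (ends G e) = 2" if "e \<in> edges G" for e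
    using assms that by (auto simp: oriented_def)
  show "oriented (Sub G) (\<lambda>(e, v). Inr e) (\<lambda>(e, v). Inl v)"
    using assms fin by (auto simp: oriented_def Sub_def)
  show "card (edges (Sub G)) = 2 * card (edges G)"
    using assms fin by (simp add: Sub_def oriented_def mult.commute)
qed

lemma sidorenko_Sub_step:
  assumes R: "regular_KNRS G" and G: "oriented G h t" and n: "0 < n"
    and M: "\<And>i j. i < n \<Longrightarrow> j < n \<Longrightarrow> M i j = M j i" "\<And>i j. i < n \<Longrightarrow> j < n \<Longrightarrow> 0 \<le> M i j \<and> M i j \<le> 1"
  defines "W \<equiv> step_kernel (uniform_cell n) M"
  shows "graphon W" "hom_density K2 W ^ (2 * card (edges G)) \<le> hom_density (Sub G) W"
proof -
  note s = cell_map_uniform[OF n]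
  have sn: "uniform_cell n x < n" if "x \<in> I01" for x using uniform_cell_close[OF n that] by simp
  show W: "graphon W"
    using step_kernel_measurable[OF s] sn M
    by (auto simp: graphon_def W_def step_kernel_def)
  let ?\<mu> = "\<lambda>_. 1 / real n"
  have "hom_density K2 W = (\<Sum>i<n. \<Sum>j<n. ?\<mu> i * ?\<mu> j * M i j)"
    unfolding hom_density_K2[OF graphon_imp_kernel[OF W]] unfolding W_def
    using step_kernel_integral[OF _ s, of I01] s by (simp add: cell_map_def)
  moreover have "hom_density (Sub G) W
      = weighted_density (verts G) (edges G) h t {..<n} ?\<mu> (codegree {..<n} ?\<mu> M)"
  proof -
    have "hom_density (Sub G) W = density_on (verts (Sub G)) (edges (Sub G)) (\<lambda>(e, v). Inr e) (\<lambda>(e, v). Inl v) W"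
      using W by (intro hom_density_oriented[OF oriented_Sub(1)[OF G]]) (simp add: graphon_def)
    also have "\<dots> = weighted_density (verts (Sub G)) (edges (Sub G)) (\<lambda>(e, v). Inr e) (\<lambda>(e, v). Inl v) {..<n} ?\<mu> M"
      unfolding W_def using oriented_Sub(1)[OF G]
      by (intro density_on_step_kernel[OF _ _ _ _ s]) (auto simp: oriented_def)
    also have "\<dots> = weighted_density (verts G) (edges G) h t {..<n} ?\<mu> (codegree {..<n} ?\<mu> M)"
      using weighted_density_subdivision[of "verts G" "edges G" "{..<n}" "ends G" h t ?\<mu> M] G
      by (simp add: Sub_def oriented_def)
    finally show ?thesis .
  qed
  moreover have "(\<Sum>i<n. \<Sum>j<n. ?\<mu> i * ?\<mu> j * M i j) ^ (2 * card (edges G))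
      \<le> weighted_density (verts G) (edges G) h t {..<n} ?\<mu> (codegree {..<n} ?\<mu> M)"
  proof (rule finite_sidorenko[OF regular_KNRS_imp_finite[OF R G]])
    show "weighting {..<n} ?\<mu>" using n by (simp add: weighting_def)
    show "symmetric_nonneg {..<n} M" using M by (auto simp: symmetric_nonneg_def)
  qed (use G in \<open>auto simp: oriented_def\<close>)
  ultimately show "hom_density K2 W ^ (2 * card (edges G)) \<le> hom_density (Sub G) W" by simp
qed

text \<open>A continuous graphon is the pointwise limit of the step graphons that sample it at the left end points
of a uniform partition.\<close>

lemma sidorenko_Sub_continuous:
  assumes R: "regular_KNRS G" and G: "loopless_multigraph G"
    and W: "graphon W" "continuous_on UNIV W"
  shows "hom_density K2 W ^ (2 * card (edges G)) \<le> hom_density (Sub G) W"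
proof -
  obtain h t where o: "oriented G h t" using loopless_orientable[OF G] .
  define M where "M = (\<lambda>n i j. W (real i / real (Suc n), real j / real (Suc n)))"
  define U where "U = (\<lambda>n. step_kernel (uniform_cell (Suc n)) (M n))"
  have M: "M n i j = M n j i" "0 \<le> M n i j \<and> M n i j \<le> 1" if "i < Suc n" "j < Suc n" for n i j
  proof -
    have "real i / real (Suc n) \<in> I01" "real j / real (Suc n) \<in> I01" using that by auto
    then show "M n i j = M n j i" "0 \<le> M n i j \<and> M n i j \<le> 1"
      using W(1) unfolding graphon_def M_def image_subset_iff by (blast, auto)
  qed
  show ?thesis
  proof (rule sidorenko_by_approximation[OF loopless_multigraph_Sub[OF G] _ W(1)])
    show "graphon (U n)" "hom_density K2 (U n) ^ (2 * card (edges G)) \<le> hom_density (Sub G) (U n)" for n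
      using sidorenko_Sub_step[OF R o, of "Suc n" "M n"] M[of _ n] unfolding U_def by blast+
    show "AE p in lebesgue_on (I01 \<times> I01). (\<lambda>n. U n p) \<longlonglongrightarrow> W p"
    proof (rule AE_I2)
      fix p assume "p \<in> space (lebesgue_on (I01 \<times> I01))"
      then have p: "fst p \<in> I01" "snd p \<in> I01" by auto
      have c: "(\<lambda>n. real (uniform_cell (Suc n) x) / real (Suc n)) \<longlonglongrightarrow> x" if "x \<in> I01" for x
      proof (rule Lim_transform_bound[where g = "\<lambda>n. 1 / real (Suc n)", THEN LIM_zero_cancel])
        show "\<forall>\<^sub>F n in sequentially. norm (real (uniform_cell (Suc n) x) / real (Suc n) - x) \<le> norm (1 / real (Suc n))"
          using uniform_cell_close(2)[OF _ that] by (intro always_eventually allI) (simp del: of_nat_Suc)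
        show "(\<lambda>n. 1 / real (Suc n)) \<longlonglongrightarrow> 0" using LIMSEQ_inverse_real_of_nat by (simp add: inverse_eq_divide)
      qed
      have "isCont W p" using W(2) continuous_on_eq_continuous_at[OF open_UNIV, of W] by blast
      then have "(\<lambda>n. W (real (uniform_cell (Suc n) (fst p)) / real (Suc n),
          real (uniform_cell (Suc n) (snd p)) / real (Suc n))) \<longlonglongrightarrow> W (fst p, snd p)"
        using tendsto_Pair[OF c[OF p(1)] c[OF p(2)]] by (intro isCont_tendsto_compose[of _ W]) auto
      then show "(\<lambda>n. U n p) \<longlonglongrightarrow> W p" by (simp add: U_def M_def step_kernel_def)
    qed
  qed
qed

text \<open>Measurable functions are almost everywhere limits of continuous ones. Evaluating at the sorted pair makes the
approximants symmetric without losing continuity, and clipping gives them values in \<open>[0, 1]\<close>. Convergence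
at \<open>p\<close> now fails only if \<open>p\<close> or its mirror image is exceptional.\<close>

lemma graphon_AE_limit_of_continuous:
  assumes W: "graphon W"
  obtains U where "\<And>n. graphon (U n)" "\<And>n. continuous_on UNIV (U n)"
    "AE p in lebesgue_on (I01 \<times> I01). (\<lambda>n. U n p) \<longlonglongrightarrow> W p"
proof -
  have "W measurable_on (I01 \<times> I01)"
    using W by (subst measurable_on_iff_borel_measurable) (auto simp: graphon_def)
  then obtain N g where N: "negligible N" and g: "\<And>n. continuous_on UNIV (g n)"
    and lim: "\<And>p. p \<notin> N \<Longrightarrow> (\<lambda>n. g n p) \<longlonglongrightarrow> (if p \<in> I01 \<times> I01 then W p else 0)"
    unfolding measurable_on_def by blast
  define srt where "srt = (\<lambda>p :: real \<times> real. (min (fst p) (snd p), max (fst p) (snd p)))"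
  define U where "U = (\<lambda>n p. max 0 (min 1 (g n (srt p))))"
  have cU: "continuous_on UNIV (U n)" for n
  proof -
    have "continuous_on UNIV srt" unfolding srt_def by (intro continuous_intros)
    then have "continuous_on UNIV (\<lambda>p. g n (srt p))"
      using continuous_on_compose2[OF g] by blast
    then show ?thesis unfolding U_def by (intro continuous_intros)
  qed
  have gU: "graphon (U n)" for n
  proof -
    have "U n \<in> borel_measurable (lebesgue_on (I01 \<times> I01))"
      by (rule measurable_compose[OF id_measurable_lebesgue_on borel_measurable_continuous_onI[OF cU]])
    then show ?thesis by (auto simp: graphon_def U_def srt_def min.commute max.commute)
  qed
  have "linear (\<lambda>p :: real \<times> real. (snd p, fst p))"
    by (auto simp: linear_iff)
  then have N2: "negligible ((\<lambda>p. (snd p, fst p)) ` N)"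
    by (intro negligible_differentiable_image_negligible N linear_imp_differentiable_on) auto
  then have "AE p in lebesgue. p \<notin> N \<union> (\<lambda>p. (snd p, fst p)) ` N"
    using N by (intro AE_not_in null_sets.Un) (simp_all add: negligible_iff_null_sets)
  then have "AE p in lebesgue_on (I01 \<times> I01). p \<notin> N \<union> (\<lambda>p. (snd p, fst p)) ` N"
    by (subst AE_restrict_space_iff) auto
  then have "AE p in lebesgue_on (I01 \<times> I01). (\<lambda>n. U n p) \<longlonglongrightarrow> W p"
    using AE_space
  proof eventually_elim
    fix p assume p: "p \<notin> N \<union> (\<lambda>p. (snd p, fst p)) ` N" "p \<in> space (lebesgue_on (I01 \<times> I01))"
    then have I: "fst p \<in> I01" "snd p \<in> I01" by auto
    have "(snd p, fst p) \<notin> N"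
    proof
      assume "(snd p, fst p) \<in> N"
      from imageI[OF this, of "\<lambda>p. (snd p, fst p)"] show False using p(1) by simp
    qed
    then have "srt p \<notin> N" using p(1) by (cases "fst p \<le> snd p") (auto simp: srt_def min_def max_def)
    moreover have "srt p \<in> I01 \<times> I01" using I by (simp add: srt_def min_def max_def)
    moreover have "W (srt p) = W p"
    proof (cases "fst p \<le> snd p")
      case False
      then have "srt p = (snd p, fst p)" by (simp add: srt_def)
      moreover have "W (snd p, fst p) = W (fst p, snd p)" using W I by (simp only: graphon_def)
      ultimately show ?thesis by simp
    qed (simp add: srt_def)
    ultimately have "(\<lambda>n. g n (srt p)) \<longlonglongrightarrow> W p" using lim[of "srt p"] by simp
    then have "(\<lambda>n. U n p) \<longlonglongrightarrow> max 0 (min 1 (W p))" unfolding U_def by (intro tendsto_intros)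
    moreover have "W p \<in> {0..1}" using W p(2) by (auto simp: graphon_def image_subset_iff)
    ultimately show "(\<lambda>n. U n p) \<longlonglongrightarrow> W p" by simp
  qed
  with gU cU show thesis by (rule that)
qed

lemma regular_KNRS_imp_sidorenko_Sub:
  assumes "loopless_multigraph G" "regular_KNRS G"
  shows "sidorenko (Sub G)"
  unfolding sidorenko_def
proof (intro allI impI)
  fix W assume W: "graphon W"
  obtain U where U: "\<And>n. graphon (U n)" "\<And>n. continuous_on UNIV (U n)"
    "AE p in lebesgue_on (I01 \<times> I01). (\<lambda>n. U n p) \<longlonglongrightarrow> W p"
    using graphon_AE_limit_of_continuous[OF W] by blast
  obtain h t where "oriented G h t" using loopless_orientable[OF assms(1)] .
  then have "card (edges (Sub G)) = 2 * card (edges G)" by (rule oriented_Sub)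
  then show "hom_density K2 W ^ card (edges (Sub G)) \<le> hom_density (Sub G) W"
    using sidorenko_by_approximation[OF loopless_multigraph_Sub[OF assms(1)] U(1) W U(3)]
      sidorenko_Sub_continuous[OF assms(2,1) U(1,2)] by simp
qed

section \<open>Positivity of bilinear forms of kernels\<close>

definition kernel_form :: "(real \<times> real \<Rightarrow> real) \<Rightarrow> (real \<Rightarrow> real) \<Rightarrow> (real \<Rightarrow> real) \<Rightarrow> real" where
  "kernel_form K f g = (LINT p|(unif \<Otimes>\<^sub>M unif). f (fst p) * K p * g (snd p))"

definition bounded_borel :: "('a::topological_space \<Rightarrow> real) \<Rightarrow> bool" where
  "bounded_borel f \<longleftrightarrow> f \<in> borel_measurable borel \<and> (\<exists>C. \<forall>x. \<bar>f x\<bar> \<le> C)"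

lemma sets_pair_unif: "sets (unif \<Otimes>\<^sub>M unif) = sets borel"
  unfolding pair_unif by simp

lemma pair_unif_measurable: "f \<in> borel_measurable borel \<Longrightarrow> f \<in> borel_measurable (unif \<Otimes>\<^sub>M unif)"
  by (simp cong: measurable_cong_sets add: sets_pair_unif measurable_cong_sets[OF sets_pair_unif refl])

lemma finite_measure_pair_unif: "finite_measure (unif \<Otimes>\<^sub>M unif)"
  unfolding pair_unif
proof (rule finite_measure.finite_measure_distr)
  show "finite_measure (lebesgue_on (I01 \<times> I01))"
  proof (rule finite_measureI)
    show "emeasure (lebesgue_on (I01 \<times> I01)) (space (lebesgue_on (I01 \<times> I01))) \<noteq> \<infinity>"
      using square_sets(1)
      by (simp add: emeasure_restrict_space lborel_prod[symmetric] lborel.emeasure_pair_measure_Times)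
  qed
qed (rule id_measurable_lebesgue_on)

interpretation unif: finite_measure unif by (rule finite_measure_unif)
interpretation unif2: finite_measure "unif \<Otimes>\<^sub>M unif" by (rule finite_measure_pair_unif)
interpretation unif_pair: pair_sigma_finite unif unif by standard

lemma unif_measurable: "f \<in> borel_measurable borel \<Longrightarrow> f \<in> borel_measurable unif"
  by (simp add: measurable_cong_sets[OF sets_unif refl])

lemma measure_unif_UNIV: "measure unif UNIV = 1"
  by (simp add: measure_def emeasure_unif)

lemma bounded_borel_integrable:
  assumes "bounded_borel f"
  shows "integrable (unif \<Otimes>\<^sub>M unif) f"
proof -
  obtain C where "\<And>p. norm (f p) \<le> C" using assms by (auto simp: bounded_borel_def)
  then show ?thesis
    using assms by (intro unif2.integrable_const_bound[of f C] pair_unif_measurable AE_I2) (auto simp: bounded_borel_def)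
qed

lemma bounded_borel_mult: "bounded_borel f \<Longrightarrow> bounded_borel g \<Longrightarrow> bounded_borel (\<lambda>x. f x * g x)"
  unfolding bounded_borel_def
proof (elim conjE exE, intro conjI)
  fix C D assume "\<forall>x. \<bar>f x\<bar> \<le> C" "\<forall>x. \<bar>g x\<bar> \<le> D"
  then have "\<bar>f x * g x\<bar> \<le> C * D" for x
    unfolding abs_mult by (intro mult_mono) (auto intro: order.trans[OF abs_ge_zero])
  then show "\<exists>C. \<forall>x. \<bar>f x * g x\<bar> \<le> C" by blast
qed simp

lemma bounded_borel_add: "bounded_borel f \<Longrightarrow> bounded_borel g \<Longrightarrow> bounded_borel (\<lambda>x. f x + g x)"
  unfolding bounded_borel_def
proof (elim conjE exE, intro conjI)
  fix C D assume "\<forall>x. \<bar>f x\<bar> \<le> C" "\<forall>x. \<bar>g x\<bar> \<le> D"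
  then have "\<bar>f x + g x\<bar> \<le> C + D" for x
    by (intro order.trans[OF abs_triangle_ineq] add_mono) auto
  then show "\<exists>C. \<forall>x. \<bar>f x + g x\<bar> \<le> C" by blast
qed simp

lemma bounded_borel_const: "bounded_borel (\<lambda>_. c)"
  by (auto simp: bounded_borel_def)

lemma bounded_borel_indicator: "A \<in> sets borel \<Longrightarrow> bounded_borel (indicator A)"
  by (auto simp: bounded_borel_def indicator_def intro!: exI[of _ 1])

lemma bounded_borel_fst_snd:
  assumes "bounded_borel (f :: real \<Rightarrow> real)"
  shows "bounded_borel (\<lambda>p :: real \<times> real. f (fst p))" "bounded_borel (\<lambda>p :: real \<times> real. f (snd p))"
  using assms unfolding bounded_borel_def
  by (auto intro: measurable_compose[OF borel_measurable_continuous_onI[OF continuous_on_fst[OF continuous_on_id]]]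
    measurable_compose[OF borel_measurable_continuous_onI[OF continuous_on_snd[OF continuous_on_id]]])

lemma bounded_borel_kernel_form:
  fixes f g :: "real \<Rightarrow> real" and K :: "real \<times> real \<Rightarrow> real"
  assumes "bounded_borel K" "bounded_borel f" "bounded_borel g"
  shows "bounded_borel (\<lambda>p. f (fst p) * K p * g (snd p))"
  by (intro bounded_borel_mult bounded_borel_fst_snd(1)[OF assms(2)] bounded_borel_fst_snd(2)[OF assms(3)] assms(1))

lemmas kernel_form_integrable = bounded_borel_integrable[OF bounded_borel_kernel_form]

lemma kernel_form_add:
  assumes K: "bounded_borel K" and f: "bounded_borel f" "bounded_borel f'" and g: "bounded_borel g" "bounded_borel g'"
  shows "kernel_form K (\<lambda>x. f x + f' x) (\<lambda>x. g x + g' x) = kernel_form K f g + kernel_form K f g' + kernel_form K f' g + kernel_form K f' g'"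
proof -
  have "kernel_form K (\<lambda>x. f x + f' x) (\<lambda>x. g x + g' x)
      = (LINT p|(unif \<Otimes>\<^sub>M unif). f (fst p) * K p * g (snd p) + f (fst p) * K p * g' (snd p)
          + f' (fst p) * K p * g (snd p) + f' (fst p) * K p * g' (snd p))"
    unfolding kernel_form_def by (intro Bochner_Integration.integral_cong refl) (simp add: algebra_simps)
  also have "\<dots> = kernel_form K f g + kernel_form K f g' + kernel_form K f' g + kernel_form K f' g'"
    unfolding kernel_form_def using kernel_form_integrable[OF K] f g by simp
  finally show ?thesis .
qed

lemma kernel_form_scale: "kernel_form K (\<lambda>x. c * f x) (\<lambda>x. d * g x) = c * d * kernel_form K f g"
proof -
  have "kernel_form K (\<lambda>x. c * f x) (\<lambda>x. d * g x) = (LINT p|(unif \<Otimes>\<^sub>M unif). (c * d) * (f (fst p) * K p * g (snd p)))"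
    unfolding kernel_form_def by (intro Bochner_Integration.integral_cong refl) (simp add: algebra_simps)
  then show ?thesis unfolding kernel_form_def by simp
qed

lemma kernel_form_fubini:
  assumes K: "bounded_borel K" and f: "bounded_borel f" and g: "bounded_borel g"
  shows "kernel_form K f g = (LINT x|unif. f x * (LINT y|unif. K (x, y) * g y))"
    and "kernel_form K f g = (LINT y|unif. g y * (LINT x|unif. f x * K (x, y)))"
    and "integrable unif (\<lambda>x. f x * (LINT y|unif. K (x, y) * g y))"
    and "integrable unif (\<lambda>y. g y * (LINT x|unif. f x * K (x, y)))"
proof -
  note I = kernel_form_integrable[OF K f g]
  have I': "integrable (unif \<Otimes>\<^sub>M unif) (\<lambda>(x, y). f x * K (x, y) * g y)"
    using I by (simp add: case_prod_unfold)
  have e1: "(LINT y|unif. f x * K (x, y) * g y) = f x * (LINT y|unif. K (x, y) * g y)" for x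
    by (simp only: mult.assoc) simp
  have e2: "(LINT x|unif. f x * K (x, y) * g y) = g y * (LINT x|unif. f x * K (x, y))" for y
    by (simp add: mult.commute)
  show "kernel_form K f g = (LINT x|unif. f x * (LINT y|unif. K (x, y) * g y))"
    unfolding kernel_form_def e1[symmetric] using unif_pair.integral_fst'[OF I'] by (simp add: case_prod_unfold)
  show "kernel_form K f g = (LINT y|unif. g y * (LINT x|unif. f x * K (x, y)))"
    unfolding kernel_form_def e2[symmetric] using unif_pair.integral_snd[OF I'] by (simp add: case_prod_unfold)
  show "integrable unif (\<lambda>x. f x * (LINT y|unif. K (x, y) * g y))"
    unfolding e1[symmetric] using unif_pair.integrable_fst'[OF I'] by (simp add: case_prod_unfold)
  show "integrable unif (\<lambda>y. g y * (LINT x|unif. f x * K (x, y)))"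
    unfolding e2[symmetric] using unif_pair.integrable_snd[OF I'] by (simp add: case_prod_unfold)
qed

text \<open>This quadratic term is the error of the rounding step below.\<close>

lemma kernel_form_local_bound:
  assumes K: "bounded_borel K" "\<And>p. \<bar>K p\<bar> \<le> 1" and J: "J \<in> sets borel"
    and f: "bounded_borel f" "\<And>x. 0 \<le> f x \<and> f x \<le> indicator J x"
  shows "\<bar>kernel_form K f f\<bar> \<le> (measure unif J)\<^sup>2"
proof -
  have JJ: "J \<times> J \<in> sets (unif \<Otimes>\<^sub>M unif)"
    unfolding sets_pair_unif by (rule borel_Times[OF J J])
  have "\<bar>kernel_form K f f\<bar> \<le> (LINT p|(unif \<Otimes>\<^sub>M unif). indicator (J \<times> J) p)"
    unfolding kernel_form_def
  proof (rule integral_abs_bound_integral)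
    show "integrable (unif \<Otimes>\<^sub>M unif) (\<lambda>p. indicator (J \<times> J) p :: real)"
      using JJ by (intro integrable_real_indicator) (simp_all add: less_top[symmetric])
    show "\<bar>f (fst p) * K p * f (snd p)\<bar> \<le> indicator (J \<times> J) p" for p
    proof -
      have "\<bar>f (fst p) * K p * f (snd p)\<bar> \<le> indicator J (fst p) * 1 * indicator J (snd p)"
        unfolding abs_mult using f(2)[of "fst p"] f(2)[of "snd p"] K(2)[of p] by (intro mult_mono) auto
      then show ?thesis by (auto simp: indicator_def mem_Times_iff)
    qed
  qed (rule kernel_form_integrable[OF K(1) f(1) f(1)])
  also have "\<dots> = measure (unif \<Otimes>\<^sub>M unif) (J \<times> J)"
    using JJ sets.sets_into_space[OF JJ] by (simp add: Int_absorb2)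
  also have "\<dots> = (measure unif J)\<^sup>2"
    using J by (simp add: measure_def unif.emeasure_pair_measure_Times sets_unif enn2real_mult power2_eq_square)
  finally show ?thesis .
qed

text \<open>Split \<open>f = g + h\<close> with \<open>h\<close> supported on \<open>J\<close>. The part of the form that is linear in \<open>h\<close> equals \<open>\<integral> h \<phi>\<close>, where \<open>\<phi>\<close> depends on
\<open>g\<close> alone; among functions with values in \<open>[0, 1]\<close> on \<open>J\<close> it is smallest for the indicator of
the points of \<open>J\<close> where \<open>\<phi>\<close> is negative. Only the part quadratic in \<open>h\<close> can increase.\<close>

lemma kernel_form_round_on_set:
  assumes K: "bounded_borel K" "\<And>p. \<bar>K p\<bar> \<le> 1" and J: "J \<in> sets borel"
    and f: "f \<in> borel_measurable borel" "\<And>x. 0 \<le> f x \<and> f x \<le> 1"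
  obtains f' where "f' \<in> borel_measurable borel" "\<And>x. 0 \<le> f' x \<and> f' x \<le> 1"
    "\<And>x. x \<notin> J \<Longrightarrow> f' x = f x" "\<And>x. x \<in> J \<Longrightarrow> f' x \<in> {0, 1}"
    "kernel_form K f' f' \<le> kernel_form K f f + 2 * (measure unif J)\<^sup>2"
proof -
  define g where "g = (\<lambda>x. f x * indicator (- J) x)"
  define \<phi> where "\<phi> = (\<lambda>x. (LINT y|unif. K (x, y) * g y) + (LINT y|unif. g y * K (y, x)))"
  \<comment> \<open>The rounded function is the indicator of \<open>T\<close> on \<open>J\<close>.\<close>
  define T where "T = {x \<in> J. \<phi> x < 0}"
  define h where "h = (\<lambda>x. f x * indicator J x)"
  have nJ: "- J \<in> sets borel" using J by auto
  have bf: "bounded_borel f" using f by (auto simp: bounded_borel_def intro!: exI[of _ 1])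
  have bg: "bounded_borel g" unfolding g_def using bf nJ by (intro bounded_borel_mult bounded_borel_indicator)
  have bh: "bounded_borel h" unfolding h_def using bf J by (intro bounded_borel_mult bounded_borel_indicator)
  have int1: "integrable unif (\<lambda>x. LINT y|unif. K (x, y) * g y)" "integrable unif (\<lambda>x. LINT y|unif. g y * K (y, x))"
    using kernel_form_fubini(3)[OF K(1) bounded_borel_const[of 1] bg] kernel_form_fubini(4)[OF K(1) bg bounded_borel_const[of 1]]
    by simp_all
  then have "\<phi> \<in> borel_measurable unif" unfolding \<phi>_def by (intro borel_measurable_add) auto
  then have \<phi>m: "\<phi> \<in> borel_measurable borel" by (simp add: measurable_cong_sets[OF sets_unif refl])
  have T: "T \<in> sets borel"
    using J \<phi>m unfolding T_def by measurable
  have bT: "bounded_borel (indicator T)" using T by (rule bounded_borel_indicator)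
  have lin: "kernel_form K g k + kernel_form K k g = (LINT x|unif. k x * \<phi> x)" "integrable unif (\<lambda>x. k x * \<phi> x)"
    if k: "bounded_borel k" for k
  proof -
    have "k x * \<phi> x = k x * (LINT y|unif. K (x, y) * g y) + k x * (LINT y|unif. g y * K (y, x))" for x
      by (simp add: \<phi>_def algebra_simps)
    then show "kernel_form K g k + kernel_form K k g = (LINT x|unif. k x * \<phi> x)" "integrable unif (\<lambda>x. k x * \<phi> x)"
      using kernel_form_fubini(1,3)[OF K(1) k bg] kernel_form_fubini(2,4)[OF K(1) bg k] by simp_all
  qed
  have "(LINT x|unif. indicator T x * \<phi> x) \<le> (LINT x|unif. h x * \<phi> x)"
  proof (rule integral_mono[OF lin(2)[OF bT] lin(2)[OF bh]])
    fix x
    have "min 0 (\<phi> x) \<le> f x * \<phi> x"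
    proof (cases "\<phi> x < 0")
      case True
      then show ?thesis using f(2)[of x] by (simp add: min_def mult_le_cancel_right1)
    next
      case False
      then show ?thesis using f(2)[of x] by (simp add: min_def)
    qed
    then show "indicator T x * \<phi> x \<le> h x * \<phi> x"
      by (auto simp: T_def h_def indicator_def)
  qed
  then have "kernel_form K g (indicator T) + kernel_form K (indicator T) g \<le> kernel_form K g h + kernel_form K h g"
    using lin(1)[OF bT] lin(1)[OF bh] by simp
  moreover have "\<bar>kernel_form K h h\<bar> \<le> (measure unif J)\<^sup>2"
    using f(2) by (intro kernel_form_local_bound[OF K J bh]) (auto simp: h_def indicator_def)
  moreover have "\<bar>kernel_form K (indicator T) (indicator T)\<bar> \<le> (measure unif J)\<^sup>2"
    by (intro kernel_form_local_bound[OF K J bT]) (auto simp: T_def indicator_def)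
  moreover have "kernel_form K f f = kernel_form K g g + kernel_form K g h + kernel_form K h g + kernel_form K h h"
  proof -
    have "f = (\<lambda>x. g x + h x)" by (auto simp: g_def h_def indicator_def)
    then show ?thesis using kernel_form_add[OF K(1) bg bh bg bh] by simp
  qed
  moreover have "kernel_form K (\<lambda>x. g x + indicator T x) (\<lambda>x. g x + indicator T x)
      = kernel_form K g g + kernel_form K g (indicator T) + kernel_form K (indicator T) g + kernel_form K (indicator T) (indicator T)"
    by (rule kernel_form_add[OF K(1) bg bT bg bT])
  ultimately have "kernel_form K (\<lambda>x. g x + indicator T x) (\<lambda>x. g x + indicator T x) \<le> kernel_form K f f + 2 * (measure unif J)\<^sup>2"
    by linarith
  moreover have "(\<lambda>x. g x + indicator T x) \<in> borel_measurable borel"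
    using bounded_borel_add[OF bg bT] by (simp add: bounded_borel_def)
  ultimately show thesis
    using f(2) by (intro that[of "\<lambda>x. g x + indicator T x"]) (auto simp: g_def T_def indicator_def)
qed

text \<open>Rounding on \<open>n\<close> sets of measure \<open>1 / n\<close> in turn produces an indicator function and increases the form by at most
\<open>n * 2 / n\<^sup>2 = 2 / n\<close>.\<close>

lemma kernel_form_nonneg_of_indicators:
  assumes K: "bounded_borel K" "\<And>p. \<bar>K p\<bar> \<le> 1"
    and ind: "\<And>S. S \<in> sets borel \<Longrightarrow> 0 \<le> kernel_form K (indicator S) (indicator S)"
    and f: "f \<in> borel_measurable borel" "\<And>x. 0 \<le> f x \<and> f x \<le> 1"
  shows "0 \<le> kernel_form K f f"
proof -
  have bound: "- 2 / real n \<le> kernel_form K f f" if n: "0 < n" for n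
  proof -
    \<comment> \<open>The minimum makes the \<open>n\<close> sets cover the whole line; \<open>unif\<close> does not see the points outside \<open>[0, 1]\<close>.\<close>
    define J where "J = (\<lambda>i. {x :: real. min (uniform_cell n x) (n - 1) = i})"
    have um: "uniform_cell n \<in> borel \<rightarrow>\<^sub>M count_space UNIV" using cell_map_uniform[OF n] by (simp add: cell_map_def)
    have J: "J i \<in> sets borel" for i
    proof -
      have "(\<lambda>x. min (uniform_cell n x) (n - 1)) \<in> borel \<rightarrow>\<^sub>M count_space UNIV"
        using measurable_compose[OF um, of "\<lambda>k. min k (n - 1)" "count_space UNIV"] by simp
      from cell_sets[OF this, of i] show ?thesis by (simp add: J_def vimage_def)
    qed
    have mJ: "measure unif (J i) = 1 / real n" if "i < n" for i
    proof -
      have mn: "min (uniform_cell n x) (n - 1) = uniform_cell n x" if "x \<in> I01" for x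
        using uniform_cell_close(1)[OF n that] by simp
      have eq: "J i \<inter> I01 = I01 \<inter> uniform_cell n -` {i}"
      proof (rule set_eqI)
        fix x
        show "x \<in> J i \<inter> I01 \<longleftrightarrow> x \<in> I01 \<inter> uniform_cell n -` {i}"
        proof (cases "x \<in> I01")
          case True
          from mn[OF True] True show ?thesis
            by (simp only: J_def mem_Collect_eq Int_iff vimage_eq singleton_iff simp_thms)
        qed blast
      qed
      have "J i \<inter> I01 \<in> sets borel" using J[of i] by auto
      then have "measure unif (J i) = measure lebesgue (J i \<inter> I01)"
        using J[of i] by (simp add: measure_def emeasure_unif)
      then have "measure unif (J i) = measure lebesgue (I01 \<inter> uniform_cell n -` {i})"
        unfolding eq .
      then show ?thesis using cell_map_uniform[OF n] that by (simp add: cell_map_def)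
    qed
    have "\<exists>g. g \<in> borel_measurable borel \<and> (\<forall>x. 0 \<le> g x \<and> g x \<le> 1) \<and> (\<forall>i<k. \<forall>x\<in>J i. g x \<in> {0, 1})
        \<and> kernel_form K g g \<le> kernel_form K f f + 2 * real k / (real n)\<^sup>2" if "k \<le> n" for k
      using that
    proof (induction k)
      case 0
      then show ?case using f by auto
    next
      case (Suc k)
      then obtain g where g: "g \<in> borel_measurable borel" "\<And>x. 0 \<le> g x \<and> g x \<le> 1" "\<forall>i<k. \<forall>x\<in>J i. g x \<in> {0, 1}"
        "kernel_form K g g \<le> kernel_form K f f + 2 * real k / (real n)\<^sup>2" by auto
      obtain g' where g': "g' \<in> borel_measurable borel" "\<And>x. 0 \<le> g' x \<and> g' x \<le> 1"
        "\<And>x. x \<notin> J k \<Longrightarrow> g' x = g x" "\<And>x. x \<in> J k \<Longrightarrow> g' x \<in> {0, 1}"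
        "kernel_form K g' g' \<le> kernel_form K g g + 2 * (measure unif (J k))\<^sup>2"
        using kernel_form_round_on_set[OF K J g(1,2)] by blast
      have "kernel_form K g' g' \<le> kernel_form K f f + 2 * real (Suc k) / (real n)\<^sup>2"
        using g(4) g'(5) Suc.prems by (simp add: mJ power_divide add_divide_distrib)
      moreover have "\<forall>i<Suc k. \<forall>x\<in>J i. g' x \<in> {0, 1}"
        using g(3) g'(3,4) by (metis less_Suc_eq)
      ultimately show ?case using g'(1,2) by blast
    qed
    from this[of n] obtain g where g: "g \<in> borel_measurable borel" "\<forall>i<n. \<forall>x\<in>J i. g x \<in> {0, 1}"
      "kernel_form K g g \<le> kernel_form K f f + 2 * real n / (real n)\<^sup>2" by blast
    have "g x \<in> {0, 1}" for x
      using g(2)[rule_format, of "min (uniform_cell n x) (n - 1)" x] n by (simp add: J_def)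
    then have "g = indicator {x. g x = 1}" by (auto simp: indicator_def fun_eq_iff)
    moreover have "{x. g x = 1} \<in> sets borel" using g(1) by measurable
    ultimately have "0 \<le> kernel_form K g g" using ind by metis
    then show ?thesis using g(3) n by (simp add: power2_eq_square)
  qed
  have "(\<lambda>n. - 2 / real (Suc n)) \<longlonglongrightarrow> 0"
    using tendsto_mult_right_zero[OF LIMSEQ_inverse_real_of_nat, of "- 2"] by (simp add: divide_inverse)
  then show ?thesis
    by (rule LIMSEQ_le_const2) (intro exI[of _ 0] allI impI bound zero_less_Suc)
qed

text \<open>Vanishing row and column integrals make the form invariant under adding constants, so a bounded function may
be replaced by a multiple of one with values in \<open>[0, 1]\<close>.\<close>

lemma kernel_form_nonneg:
  assumes K: "bounded_borel K" "\<And>p. \<bar>K p\<bar> \<le> 1"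
    and ind: "\<And>S. S \<in> sets borel \<Longrightarrow> 0 \<le> kernel_form K (indicator S) (indicator S)"
    and row: "AE x in unif. (LINT y|unif. K (x, y)) = 0" and col: "AE y in unif. (LINT x|unif. K (x, y)) = 0"
    and f: "bounded_borel f"
  shows "0 \<le> kernel_form K f f"
proof -
  obtain C0 where C0: "\<And>x. \<bar>f x\<bar> \<le> C0" using f by (auto simp: bounded_borel_def)
  \<comment> \<open>A positive bound, so that \<open>u\<close> is well defined also for \<open>f = 0\<close>.\<close>
  define C where "C = max 1 C0"
  have C: "0 < C" "\<bar>f x\<bar> \<le> C" for x using C0[of x] by (auto simp: C_def)
  define u where "u = (\<lambda>x. (f x + C) / (2 * C))"
  have u: "u \<in> borel_measurable borel" "0 \<le> u x \<and> u x \<le> 1" for x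
    using f C(1) C(2)[of x] by (auto simp: u_def bounded_borel_def field_simps abs_le_iff)
  have bu: "bounded_borel u" using u by (auto simp: bounded_borel_def intro!: exI[of _ 1])
  have z1: "kernel_form K k (\<lambda>_. 1) = 0" if "bounded_borel k" for k
  proof -
    have "kernel_form K k (\<lambda>_. 1) = (LINT x|unif. 0)"
      unfolding kernel_form_fubini(1)[OF K(1) that bounded_borel_const]
      using row kernel_form_fubini(3)[OF K(1) that bounded_borel_const[of 1]] by (intro integral_cong_AE) auto
    then show ?thesis by simp
  qed
  have z2: "kernel_form K (\<lambda>_. 1) k = 0" if "bounded_borel k" for k
  proof -
    have "kernel_form K (\<lambda>_. 1) k = (LINT x|unif. 0)"
      unfolding kernel_form_fubini(2)[OF K(1) bounded_borel_const that]
      using col kernel_form_fubini(4)[OF K(1) bounded_borel_const[of 1] that] by (intro integral_cong_AE) auto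
    then show ?thesis by simp
  qed
  have bc: "bounded_borel (\<lambda>x. 2 * C * u x)" using bu by (intro bounded_borel_mult bounded_borel_const)
  have "f = (\<lambda>x. 2 * C * u x + - C * 1)" using C(1) by (auto simp: u_def)
  then have "kernel_form K f f = kernel_form K (\<lambda>x. 2 * C * u x + - C * 1) (\<lambda>x. 2 * C * u x + - C * 1)" by simp
  also have "\<dots> = kernel_form K (\<lambda>x. 2 * C * u x) (\<lambda>x. 2 * C * u x) + kernel_form K (\<lambda>x. 2 * C * u x) (\<lambda>x. - C * 1)
      + kernel_form K (\<lambda>x. - C * 1) (\<lambda>x. 2 * C * u x) + kernel_form K (\<lambda>x. - C * 1) (\<lambda>x. - C * 1)"
    by (rule kernel_form_add[OF K(1) bc bounded_borel_const bc bounded_borel_const])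
  also have "\<dots> = 4 * C\<^sup>2 * kernel_form K u u"
    unfolding kernel_form_scale z1[OF bu] z2[OF bu] z1[OF bounded_borel_const] by (simp add: power2_eq_square)
  finally show ?thesis
    using kernel_form_nonneg_of_indicators[OF K ind u] by simp
qed

section \<open>Locally dense regular graphons are doubly nonnegative\<close>

lemma unif_AE_iff:
  assumes "{x. P x} \<in> sets borel"
  shows "(AE x in unif. P x) \<longleftrightarrow> (AE x in lebesgue_on I01. P x)"
  unfolding unif_def by (subst AE_distr_iff[OF id_measurable_lebesgue_on]) (use assms in auto)

lemma unif_AE_imp: "AE x in unif. P x \<Longrightarrow> AE x in lebesgue_on I01. P x"
  unfolding unif_def by (rule AE_distrD[OF id_measurable_lebesgue_on])

lemma borel_measurable_lebesgue_on_AE_cong: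
  fixes f g :: "'a::euclidean_space \<Rightarrow> real"
  assumes S: "S \<in> sets lebesgue" and f: "f \<in> borel_measurable (lebesgue_on S)"
    and ae: "AE x in lebesgue_on S. f x = g x"
  shows "g \<in> borel_measurable (lebesgue_on S)"
proof -
  have f': "(\<lambda>x. if x \<in> S then f x else 0) \<in> borel_measurable lebesgue"
    using f S by (subst borel_measurable_if) auto
  have "AE x in lebesgue. x \<in> S \<longrightarrow> f x = g x"
    using ae S by (subst (asm) AE_restrict_space_iff) auto
  then have ae': "AE x in lebesgue. (if x \<in> S then f x else 0) = (if x \<in> S then g x else 0)"
    by eventually_elim auto
  show ?thesis
    using borel_measurable_completion_AE_cong[OF f' ae'] S by (subst (asm) borel_measurable_if) auto
qed

lemma borel_representative_bounded:
  assumes f: "f \<in> borel_measurable (lebesgue_on I01)" "bounded (f ` I01)"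
  obtains f' N where "bounded_borel f'" "N \<in> null_sets lborel" "\<And>x. x \<in> I01 \<Longrightarrow> x \<notin> N \<Longrightarrow> f x = f' x"
proof -
  obtain C where "\<forall>y\<in>f ` I01. norm y \<le> C" using f(2) unfolding bounded_iff by blast
  then have C: "\<bar>f x\<bar> \<le> C" if "x \<in> I01" for x using that by simp
  have "(\<lambda>x. if x \<in> I01 then f x else 0) \<in> borel_measurable lebesgue"
    using f(1) by (subst borel_measurable_if) auto
  then obtain g where g: "g \<in> borel_measurable lborel" "AE x in lborel. (if x \<in> I01 then f x else 0) = g x"
    using completion_ex_borel_measurable_real by blast
  from g(2) obtain N where N: "{x \<in> space lborel. \<not> (if x \<in> I01 then f x else 0) = g x} \<subseteq> N"
    "emeasure lborel N = 0" "N \<in> sets lborel" by (rule AE_E)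
  define f' where "f' = (\<lambda>x. max (- C) (min C (g x)))"
  have "f' \<in> borel_measurable borel" using g(1) unfolding f'_def by simp
  moreover have "\<bar>f' x\<bar> \<le> \<bar>C\<bar>" for x by (auto simp: f'_def)
  ultimately have "bounded_borel f'" by (auto simp: bounded_borel_def)
  moreover have "N \<in> null_sets lborel" using N by auto
  moreover have "f x = f' x" if "x \<in> I01" "x \<notin> N" for x
  proof -
    have "g x = f x"
    proof (rule ccontr)
      assume "g x \<noteq> f x"
      then have "x \<in> {x \<in> space lborel. \<not> (if x \<in> I01 then f x else 0) = g x}" using that(1) by simp
      then show False using N(1) that(2) by blast
    qed
    then show ?thesis using C[OF that(1)] by (simp add: f'_def abs_le_iff)
  qed
  ultimately show thesis by (rule that)
qed

text \<open>Passing to a Borel representative changes almost every section of the graphon only on a null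
set. This transfers regularity, a statement about sections, to the representative.\<close>

lemma section_integral:
  fixes W W' :: "real \<times> real \<Rightarrow> real"
  assumes W: "W' \<in> borel_measurable borel" and x: "x \<in> I01"
    and ae: "AE y in unif. y \<in> I01 \<longrightarrow> W (x, y) = W' (x, y)"
  shows "(LINT y|unif. W' (x, y)) = (LINT y:I01|lebesgue. W (x, y))"
proof -
  have W'x: "(\<lambda>y. W' (x, y)) \<in> borel_measurable borel"
    by (rule measurable_compose[OF borel_measurable_continuous_onI W]) (intro continuous_intros)
  have "AE y in lebesgue_on I01. y \<in> I01 \<longrightarrow> W (x, y) = W' (x, y)"
    using ae unfolding unif_def by (rule AE_distrD[OF id_measurable_lebesgue_on])
  then have "AE y in lebesgue. y \<in> I01 \<longrightarrow> W (x, y) = W' (x, y)"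
    by (subst (asm) AE_restrict_space_iff) auto
  then have ae': "AE y in lebesgue. indicator I01 y *\<^sub>R W' (x, y) = indicator I01 y *\<^sub>R W (x, y)"
    by eventually_elim (auto simp: indicator_def)
  have m: "(\<lambda>y. indicator I01 y *\<^sub>R W' (x, y)) \<in> borel_measurable lebesgue"
    using W'x by (intro measurable_completion) simp
  have "(LINT y|unif. W' (x, y)) = (LINT y|lebesgue_on I01. W' (x, y))"
    unfolding unif_def by (rule integral_distr[OF id_measurable_lebesgue_on W'x])
  also have "\<dots> = (LINT y:I01|lebesgue. W' (x, y))"
    unfolding set_lebesgue_integral_def by (rule integral_restrict_space) simp
  also have "\<dots> = (LINT y:I01|lebesgue. W (x, y))"
    unfolding set_lebesgue_integral_def
    using m ae' borel_measurable_completion_AE_cong[OF m ae'] by (intro integral_cong_AE)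
  finally show ?thesis .
qed

text \<open>The kernel \<open>W - \<rho>\<close> satisfies the hypotheses of \<open>kernel_form_nonneg\<close>: nonnegativity on indicators is local density,
and the vanishing row and column integrals are regularity. Adding back the constant \<open>\<rho>\<close> adds \<open>\<rho> (\<integral> f)\<^sup>2\<close> to the form. The
argument is carried out for a Borel representative \<open>W'\<close> of \<open>W\<close>, which is symmetric only almost everywhere; this
is why rows and columns are treated separately.\<close>

lemma dense_regular_imp_doubly_nonnegative:
  assumes W: "graphon W" and \<rho>: "\<rho> \<in> {0..1}" and d: "locally_dense \<rho> W" and r: "regular_graphon \<rho> W"
  shows "doubly_nonnegative W"
proof -
  have Wm: "W \<in> borel_measurable (lebesgue_on (I01 \<times> I01))" using W by (simp add: graphon_def)
  have W01: "0 \<le> W p" "W p \<le> 1" if "p \<in> I01 \<times> I01" for p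
    using W that unfolding graphon_def image_subset_iff by (metis atLeastAtMost_iff)+
  obtain W0 where W0: "W0 \<in> borel_measurable borel" "AE p in lebesgue_on (I01 \<times> I01). W p = W0 p"
    using borel_representative[OF Wm] by blast
  define W' where "W' = (\<lambda>p. max 0 (min 1 (W0 p)))"
  have W'm: "W' \<in> borel_measurable borel" using W0(1) unfolding W'_def by simp
  have W'01: "0 \<le> W' p" "W' p \<le> 1" for p by (auto simp: W'_def)
  have ae: "AE p in lebesgue_on (I01 \<times> I01). W p = W' p"
    using W0(2) AE_space
  proof eventually_elim
    case (elim p)
    then show ?case using W01[of p] by (simp add: W'_def)
  qed
  define K where "K = (\<lambda>p. W' p - \<rho>)"
  have K1: "\<bar>K p\<bar> \<le> 1" for p using W'01[of p] \<rho> by (auto simp: K_def abs_le_iff)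
  have bW: "bounded_borel W'" using W'm W'01 by (auto simp: bounded_borel_def intro!: exI[of _ 1])
  have bK: "bounded_borel K" using W'm K1 by (auto simp: bounded_borel_def K_def)
  have kernel_form_W: "kernel_form W' f f = kernel_form K f f + \<rho> * (LINT x|unif. f x)\<^sup>2" if f: "bounded_borel f" for f
  proof -
    have "kernel_form (\<lambda>_. 1) f f = (LINT x|unif. f x) * (LINT y|unif. f y)"
      using kernel_form_fubini(1)[OF bounded_borel_const f f, of 1] by simp
    moreover have "kernel_form W' f f = kernel_form K f f + \<rho> * kernel_form (\<lambda>_. 1) f f"
    proof -
      have "kernel_form W' f f = (LINT p|(unif \<Otimes>\<^sub>M unif). f (fst p) * K p * f (snd p) + \<rho> * (f (fst p) * 1 * f (snd p)))"
        unfolding kernel_form_def by (intro Bochner_Integration.integral_cong refl) (simp add: K_def algebra_simps)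
      also have "\<dots> = kernel_form K f f + \<rho> * kernel_form (\<lambda>_. 1) f f"
        unfolding kernel_form_def
        using kernel_form_integrable[OF bK f f] kernel_form_integrable[OF bounded_borel_const f f, of 1] by simp
      finally show ?thesis .
    qed
    ultimately show ?thesis by (simp add: power2_eq_square)
  qed
  have ind: "0 \<le> kernel_form K (indicator S) (indicator S)" if S: "S \<in> sets borel" for S
  proof -
    let ?S = "S \<inter> I01"
    have S': "?S \<in> sets borel" using S by auto
    have SS: "S \<times> S \<in> sets borel" using S by (intro borel_Times)
    have "(LINT p:?S \<times> ?S|lebesgue. W p) = (LINT p:I01 \<times> I01|lebesgue. indicator (S \<times> S) p * W p)"
      unfolding set_lebesgue_integral_def
      by (intro Bochner_Integration.integral_cong refl) (auto simp: indicator_def)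
    also have "\<dots> = (LINT p|(unif \<Otimes>\<^sub>M unif). indicator (S \<times> S) p * W' p)"
    proof (rule square_integral_eq_pair_unif)
      show "(\<lambda>p. indicator (S \<times> S) p * W' p) \<in> borel_measurable borel" using SS W'm by simp
      show "AE p in lebesgue_on (I01 \<times> I01). indicator (S \<times> S) p * W p = indicator (S \<times> S) p * W' p"
        using ae by eventually_elim simp
      have "indicator (S \<times> S) \<in> borel_measurable (lebesgue_on (I01 \<times> I01))"
        by (rule measurable_compose[OF id_measurable_lebesgue_on]) (use SS in simp)
      then show "(\<lambda>p. indicator (S \<times> S) p * W p) \<in> borel_measurable (lebesgue_on (I01 \<times> I01))"
        using Wm by (intro borel_measurable_times)
    qed
    also have "\<dots> = kernel_form W' (indicator S) (indicator S)"
      unfolding kernel_form_def by (intro Bochner_Integration.integral_cong refl) (auto simp: indicator_def mem_Times_iff)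
    finally have "(LINT p:?S \<times> ?S|lebesgue. W p) = kernel_form W' (indicator S) (indicator S)" .
    moreover have "\<rho> * (measure lebesgue ?S)\<^sup>2 \<le> (LINT p:?S \<times> ?S|lebesgue. W p)"
      by (rule d[unfolded locally_dense_def, rule_format]) (use S' in auto)
    moreover have "measure lebesgue ?S = (LINT x|unif. indicator S x)"
      using S S' by (simp add: measure_def emeasure_unif)
    ultimately show ?thesis using kernel_form_W[OF bounded_borel_indicator[OF S]] by simp
  qed
  obtain N where N: "N \<in> null_sets (unif \<Otimes>\<^sub>M unif)" "\<And>p. p \<in> I01 \<times> I01 \<Longrightarrow> p \<notin> N \<Longrightarrow> W p = W' p"
    using AE_lebesgue_on_square_imp_borel[OF ae] by blast
  have reg: "AE x in unif. (LINT y|unif. V (x, y)) = \<rho>"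
    if V: "bounded_borel V" and aeV: "AE x in unif. AE y in unif. x \<in> I01 \<longrightarrow> y \<in> I01 \<longrightarrow> W (x, y) = V (x, y)" for V
  proof -
    have Vm: "V \<in> borel_measurable borel" using V by (simp add: bounded_borel_def)
    have "AE x in lebesgue_on I01. AE y in unif. x \<in> I01 \<longrightarrow> y \<in> I01 \<longrightarrow> W (x, y) = V (x, y)"
      by (rule unif_AE_imp[OF aeV])
    then have "AE x in lebesgue_on I01. (LINT y|unif. V (x, y)) = \<rho>"
      using r[unfolded regular_graphon_def] AE_space
      by eventually_elim (simp add: section_integral[OF Vm])
    moreover have "(\<lambda>x. LINT y|unif. V (x, y)) \<in> borel_measurable borel"
      using kernel_form_fubini(3)[OF V bounded_borel_const[of 1] bounded_borel_const[of 1]]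
      by (simp add: measurable_cong_sets[OF sets_unif refl] borel_measurable_integrable
          flip: measurable_cong_sets[OF sets_unif refl])
    then have "{x. (LINT y|unif. V (x, y)) = \<rho>} \<in> sets borel" by measurable
    ultimately show ?thesis by (simp add: unif_AE_iff)
  qed
  have N_sections: "AE x in unif. AE y in unif. (x, y) \<notin> N" "AE x in unif. AE y in unif. (y, x) \<notin> N"
  proof -
    have 1: "AE p in unif \<Otimes>\<^sub>M unif. p \<notin> N" using N(1) by (rule AE_not_in)
    from unif_pair.AE_pair[OF 1] show "AE x in unif. AE y in unif. (x, y) \<notin> N" .
    from 1 have "AE p in distr (unif \<Otimes>\<^sub>M unif) (unif \<Otimes>\<^sub>M unif) (\<lambda>(x, y). (y, x)). p \<notin> N"
      by (subst unif_pair.distr_pair_swap[symmetric])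
    then have "AE p in unif \<Otimes>\<^sub>M unif. (case p of (x, y) \<Rightarrow> (y, x)) \<notin> N"
      by (rule AE_distrD[rotated]) (rule measurable_pair_swap')
    from unif_pair.AE_pair[OF this] show "AE x in unif. AE y in unif. (y, x) \<notin> N" by simp
  qed
  have bW2: "bounded_borel (\<lambda>p. W' (snd p, fst p))"
    using W'01 unfolding bounded_borel_def
    by (intro conjI measurable_compose[OF borel_measurable_continuous_onI W'm] continuous_intros) (auto intro!: exI[of _ 1])
  have "AE x in unif. AE y in unif. x \<in> I01 \<longrightarrow> y \<in> I01 \<longrightarrow> W (x, y) = W' (x, y)"
    using N_sections(1) by (elim eventually_mono) (auto simp: N(2))
  from reg[OF bW this] have "AE x in unif. (LINT y|unif. W' (x, y)) = \<rho>" .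
  moreover have "AE x in unif. AE y in unif. x \<in> I01 \<longrightarrow> y \<in> I01 \<longrightarrow> W (x, y) = W' (y, x)"
    using N_sections(2)
  proof (elim eventually_mono, safe)
    fix x y assume "x \<in> I01" "y \<in> I01" "(y, x) \<notin> N"
    then show "W (x, y) = W' (y, x)" using N(2)[of "(y, x)"] W by (simp add: graphon_def)
  qed
  from reg[OF bW2] this have "AE x in unif. (LINT y|unif. W' (y, x)) = \<rho>" by simp
  moreover have subtract: "(LINT y|unif. W' (g y) - \<rho>) = (LINT y|unif. W' (g y)) - \<rho>"
    if "g \<in> borel \<rightarrow>\<^sub>M borel" for g
  proof -
    have "integrable unif (\<lambda>y. W' (g y))"
      using measurable_compose[OF that W'm] W'01
      by (intro unif.integrable_const_bound[of _ 1] unif_measurable AE_I2) auto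
    then show ?thesis by (simp add: measure_unif_UNIV)
  qed
  ultimately have row: "AE x in unif. (LINT y|unif. K (x, y)) = 0" and col: "AE y in unif. (LINT x|unif. K (x, y)) = 0"
    unfolding K_def
    by (auto elim!: eventually_mono simp: subtract borel_measurable_continuous_onI continuous_intros)
  show ?thesis
    unfolding doubly_nonnegative_def
  proof (intro conjI allI impI)
    show "kernel W" by (rule graphon_imp_kernel[OF W])
    show "AE p in lebesgue_on (I01 \<times> I01). 0 \<le> W p" by (rule AE_I2) (use W01 in auto)
    fix f :: "real \<Rightarrow> real"
    assume "f \<in> borel_measurable (lebesgue_on I01) \<and> bounded (f ` I01)"
    then obtain f' M where f': "bounded_borel f'" "M \<in> null_sets lborel" "\<And>x. x \<in> I01 \<Longrightarrow> x \<notin> M \<Longrightarrow> f x = f' x"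
      using borel_representative_bounded by blast
    have bf: "bounded_borel (\<lambda>p. f' (fst p) * W' p * f' (snd p))" by (rule bounded_borel_kernel_form[OF bW f'(1) f'(1)])
    then have m': "(\<lambda>p. f' (fst p) * W' p * f' (snd p)) \<in> borel_measurable borel" by (simp add: bounded_borel_def)
    have "AE p in lebesgue. p \<notin> M \<times> UNIV \<union> UNIV \<times> M"
      by (rule AE_completion[OF AE_not_in[OF null_sets_cross[OF f'(2)]]])
    then have "AE p in lebesgue_on (I01 \<times> I01). p \<notin> M \<times> UNIV \<union> UNIV \<times> M"
      by (subst AE_restrict_space_iff) auto
    then have ae2: "AE p in lebesgue_on (I01 \<times> I01). f (fst p) * W p * f (snd p) = f' (fst p) * W' p * f' (snd p)"
      using ae AE_space
    proof eventually_elim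
      case (elim p)
      then show ?case using f'(3)[of "fst p"] f'(3)[of "snd p"] by (auto simp: mem_Times_iff)
    qed
    then have "AE p in lebesgue_on (I01 \<times> I01). f' (fst p) * W' p * f' (snd p) = f (fst p) * W p * f (snd p)"
      by eventually_elim simp
    from borel_measurable_lebesgue_on_AE_cong[OF square_sets(2) measurable_compose[OF id_measurable_lebesgue_on m'] this]
    have "(LINT p:I01 \<times> I01|lebesgue. f (fst p) * W p * f (snd p)) = kernel_form W' f' f'"
      unfolding kernel_form_def by (rule square_integral_eq_pair_unif[OF m' ae2])
    also have "\<dots> = kernel_form K f' f' + \<rho> * (LINT x|unif. f' x)\<^sup>2" by (rule kernel_form_W[OF f'(1)])
    finally show "0 \<le> (LINT p:I01 \<times> I01|lebesgue. f (fst p) * W p * f (snd p))"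
      using kernel_form_nonneg[OF bK K1 ind row col f'(1)] \<rho> by simp
  qed
qed

lemma locally_dense_integral:
  assumes "locally_dense \<rho> W"
  shows "\<rho> \<le> (LINT p:I01 \<times> I01|lebesgue. W p)"
  using assms[unfolded locally_dense_def, rule_format, of I01] by simp

theorem proposition1p4:
  fixes G :: "('v, 'e) mgraph"
  assumes "loopless_multigraph G"
  shows "(bipartite G \<and> sidorenko G \<longrightarrow> KNRS G) \<and>
         (KNRS G \<longrightarrow> regular_KNRS G) \<and>
         (sidorenko_good G \<longrightarrow> regular_KNRS G) \<and>
         (regular_KNRS G \<longrightarrow> sidorenko (Sub G)) \<and>
         (KNRS G \<longrightarrow> sidorenko (Sub G)) \<and>
         (sidorenko_good G \<longrightarrow> sidorenko (Sub G))"
proof -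
  have 1: "KNRS G" if "sidorenko G"
    unfolding KNRS_def
  proof (intro ballI allI impI)
    fix \<rho> W assume \<rho>: "\<rho> \<in> {0..1 :: real}" and W: "graphon W \<and> locally_dense \<rho> W"
    then have "\<rho> \<le> hom_density K2 W"
      by (simp add: hom_density_K2[OF graphon_imp_kernel] locally_dense_integral)
    then have "\<rho> ^ card (edges G) \<le> hom_density K2 W ^ card (edges G)" using \<rho> by (intro power_mono) auto
    also have "\<dots> \<le> hom_density G W" using that W by (simp add: sidorenko_def)
    finally show "\<rho> ^ card (edges G) \<le> hom_density G W" .
  qed
  have 2: "regular_KNRS G" if "KNRS G"
    using that unfolding KNRS_def regular_KNRS_def by blast
  have 3: "regular_KNRS G" if "sidorenko_good G"
    unfolding regular_KNRS_def
  proof (intro ballI allI impI)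
    fix \<rho> W assume \<rho>: "\<rho> \<in> {0..1 :: real}" and W: "graphon W \<and> locally_dense \<rho> W \<and> regular_graphon \<rho> W"
    then have "\<rho> ^ card (edges G) \<le> kernel_norm1 W ^ card (edges G)"
      unfolding kernel_norm1_def by (intro power_mono locally_dense_integral) auto
    also have "\<dots> \<le> hom_density G W"
      using that dense_regular_imp_doubly_nonnegative \<rho> W by (simp add: sidorenko_good_def)
    finally show "\<rho> ^ card (edges G) \<le> hom_density G W" .
  qed
  show ?thesis
    using 1 2 3 regular_KNRS_imp_sidorenko_Sub[OF assms] by blast
qed

end
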